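(* Let $X$ be a future tame [resp. past tame] complete future-directed timelike vector field on a spacetime $(M,g)$. Then the foliation of $M$ defined by the integral curves of $X$ is future omniscient [resp. past omniscient], i.e. $I^{-}(\gamma)=M$ [resp. $I^{+}(\gamma)=M$] for every maximal integral curve $\gamma$ of $X$.
   Context: A spacetime is a connected time-oriented Lorentzian manifold of dimension $n+1\geq 2$; all functions and tensors are smooth unless stated otherwise. Let $X$ be a complete future-directed timelike vector field with flow $\phi:\mathbb{R}\times M\to M$. A slice for $\phi$ is a smooth hypersurface $\Sigma\subset M$ intersected exactly once by each integral curve of $X$; such a slice exists iff the $\mathbb{R}$-action $\phi$ is proper. Given a slice $\Sigma$, the map $\phi_\Sigma:=\phi|_{\mathbb{R}\times\Sigma}:\mathbb{R}\times\Sigma\to M$ is a diffeomorphism, with $\partial_\tau$ (the coordinate field of the $\mathbb{R}$ factor) pushed forward to $X$. Let $\beta>0$ be the function on $\mathbb{R}\times\Sigma$ with $\beta^2=-\phi_\Sigma^*g(\partial_\tau,\partial_\tau)$. For $\tau\in\mathbb{R}$ and $v,w\in T_x\Sigma$, put $$\omega_\tau(v):=\phi_\Sigma^*g(\partial_\tau,(0,v))|_{(\tau,x)},\qquad h_\tau(v,w):=\phi_\Sigma^*g((0,v),(0,w))|_{(\tau,x)},$$ so that $\phi_\Sigma^*g=-\beta^2d\tau^2+\omega_\tau\otimes d\tau+d\tau\otimes\omega_\tau+h_\tau$. Define, for $v\in T_x\Sigma$, $$F^{\pm}_\tau(v):=\pm\frac{\omega_\tau(v)}{\beta(\tau,x)}+\sqrt{\frac{\omega_\tau(v)^2}{\beta(\tau,x)^2}+h_\tau(v,v)}.$$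 Given a $1$-form $\omega_0$ and a Riemannian metric $g_0$ on $\Sigma$, set $F^{\pm}(v):=\pm\omega_0(v)+\sqrt{\omega_0(v)^2+g_0(v,v)}$ for $v\in T\Sigma$. $X$ is future tame [resp. past tame] if its flow $\phi$ is a proper $\mathbb{R}$-action and for some slice $\Sigma$ there exist a positive function $\mathfrak{a}:\mathbb{R}\to\mathbb{R}$, a $1$-form $\omega_0$ and a Riemannian metric $g_0$ on $\Sigma$ such that for all $\tau\in\mathbb{R}$, $x\in\Sigma$, $v\in T_x\Sigma$, $$F^{+}_\tau(v)\leq\mathfrak{a}(\tau)\beta(\tau,x)F^{+}(v)\qquad[\text{resp. }F^{-}_\tau(v)\leq\mathfrak{a}(\tau)\beta(\tau,x)F^{-}(v)],$$ and $$\int_0^\infty\frac{ds}{\mathfrak{a}(s)}=\infty\qquad\Big[\text{resp. }\int_{-\infty}^0\frac{ds}{\mathfrak{a}(s)}=\infty\Big].$$ *)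

theory Defs
  imports "HOL-Analysis.Analysis"
begin

section \<open>Smooth manifolds\<close>

text \<open>Only used for open \<open>S\<close>, so that the derivatives at the points of \<open>S\<close> are two-sided.\<close>

primrec Ck_on :: "nat \<Rightarrow> 'a::real_normed_vector set \<Rightarrow> ('a \<Rightarrow> 'b::real_normed_vector) \<Rightarrow> bool" where
  "Ck_on 0 S f \<longleftrightarrow> continuous_on S f"
| "Ck_on (Suc k) S f \<longleftrightarrow>
     (\<forall>x\<in>S. f differentiable (at x)) \<and> (\<forall>v. Ck_on k S (\<lambda>x. frechet_derivative f (at x) v))"

definition smooth_on :: "'a::real_normed_vector set \<Rightarrow> ('a \<Rightarrow> 'b::real_normed_vector) \<Rightarrow> bool" where
  "smooth_on S f \<longleftrightarrow> (\<forall>k. Ck_on k S f)"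

text \<open>A chart is a pair \<open>(U, f)\<close>; the values of \<open>f\<close> outside \<open>U\<close> are irrelevant. The manifold is the
  whole type \<open>'m\<close>; being Hausdorff and second countable is imposed by its type classes.\<close>

type_synonym ('m, 'e) chart = "'m set \<times> ('m \<Rightarrow> 'e)"

abbreviation cdom :: "('m, 'e) chart \<Rightarrow> 'm set" where "cdom \<equiv> fst"
abbreviation cmap :: "('m, 'e) chart \<Rightarrow> 'm \<Rightarrow> 'e" where "cmap \<equiv> snd"
abbreviation cran :: "('m, 'e) chart \<Rightarrow> 'e set" where "cran c \<equiv> cmap c ` cdom c"
abbreviation cinv :: "('m, 'e) chart \<Rightarrow> 'e \<Rightarrow> 'm" where "cinv c \<equiv> inv_into (cdom c) (cmap c)"

definition is_chart :: "('m::topological_space, 'e::euclidean_space) chart \<Rightarrow> bool" where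
  "is_chart c \<longleftrightarrow> open (cdom c) \<and> open (cran c) \<and> homeomorphism (cdom c) (cran c) (cmap c) (cinv c)"

definition smooth_compatible ::
  "('m::topological_space, 'e::euclidean_space) chart \<Rightarrow> ('m, 'e) chart \<Rightarrow> bool" where
  "smooth_compatible c d \<longleftrightarrow>
     smooth_on (cmap c ` (cdom c \<inter> cdom d)) (cmap d \<circ> cinv c) \<and>
     smooth_on (cmap d ` (cdom c \<inter> cdom d)) (cmap c \<circ> cinv d)"

text \<open>A smooth structure is a maximal smooth atlas.\<close>

definition smooth_structure :: "('m::topological_space, 'e::euclidean_space) chart set \<Rightarrow> bool" where
  "smooth_structure A \<longleftrightarrow>
     (\<forall>c\<in>A. is_chart c) \<and> (\<Union>c\<in>A. cdom c) = UNIV \<and>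
     (\<forall>c\<in>A. \<forall>d\<in>A. smooth_compatible c d) \<and>
     (\<forall>c. is_chart c \<and> (\<forall>d\<in>A. smooth_compatible c d) \<longrightarrow> c \<in> A)"

section \<open>Tangent vectors and tensors\<close>

text \<open>A tangent vector at \<open>p\<close> is the family of its components in all charts around \<open>p\<close>, related by the
  derivatives of the chart transitions (equivalently, an equivalence class of triples
  \<open>(U, f, v)\<close>). Components in charts that do not contain \<open>p\<close> are set to \<open>0\<close>, so that the zero vector
  is the constant family \<open>0\<close> and vector space operations are componentwise.\<close>

type_synonym ('m, 'e) tvec = "('m, 'e) chart \<Rightarrow> 'e"

definition tangent_space ::
  "('m::topological_space, 'e::euclidean_space) chart set \<Rightarrow> 'm \<Rightarrow> ('m, 'e) tvec set" where
  "tangent_space A p = {v.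
     (\<forall>c\<in>A. \<forall>d\<in>A. p \<in> cdom c \<inter> cdom d \<longrightarrow>
        v d = frechet_derivative (cmap d \<circ> cinv c) (at (cmap c p)) (v c)) \<and>
     (\<forall>c. \<not> (c \<in> A \<and> p \<in> cdom c) \<longrightarrow> v c = 0)}"

text \<open>The tangent vector at \<open>p\<close> whose component in the chart \<open>c\<close> is \<open>u\<close>; for instance, for \<open>u\<close> a basis
  vector this is the corresponding coordinate vector field of \<open>c\<close> at \<open>p\<close>.\<close>

definition tvec_of ::
  "('m::topological_space, 'e::euclidean_space) chart set \<Rightarrow> 'm \<Rightarrow> ('m, 'e) chart \<Rightarrow> 'e \<Rightarrow> ('m, 'e) tvec" where
  "tvec_of A p c u = (\<lambda>d. if d \<in> A \<and> p \<in> cdom d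
      then frechet_derivative (cmap d \<circ> cinv c) (at (cmap c p)) u else 0)"

definition tzero :: "('m, 'e::real_vector) tvec" where
  "tzero = (\<lambda>_. 0)"

definition lincomb ::
  "real \<Rightarrow> ('m, 'e::real_vector) tvec \<Rightarrow> real \<Rightarrow> ('m, 'e) tvec \<Rightarrow> ('m, 'e) tvec" where
  "lincomb a u b v = (\<lambda>c. a *\<^sub>R u c + b *\<^sub>R v c)"

definition linear_form_on ::
  "('m, 'e::real_vector) tvec set \<Rightarrow> (('m, 'e) tvec \<Rightarrow> real) \<Rightarrow> bool" where
  "linear_form_on V f \<longleftrightarrow> (\<forall>u\<in>V. \<forall>v\<in>V. \<forall>a b. f (lincomb a u b v) = a * f u + b * f v)"

definition symmetric_bilinear_on ::
  "('m, 'e::real_vector) tvec set \<Rightarrow> (('m, 'e) tvec \<Rightarrow> ('m, 'e) tvec \<Rightarrow> real) \<Rightarrow> bool" where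
  "symmetric_bilinear_on V B \<longleftrightarrow>
     (\<forall>u\<in>V. \<forall>v\<in>V. B u v = B v u) \<and> (\<forall>u\<in>V. linear_form_on V (B u))"

definition vector_field ::
  "('m::topological_space, 'e::euclidean_space) chart set \<Rightarrow> ('m \<Rightarrow> ('m, 'e) tvec) \<Rightarrow> bool" where
  "vector_field A X \<longleftrightarrow> (\<forall>p. X p \<in> tangent_space A p) \<and>
     (\<forall>c\<in>A. smooth_on (cran c) (\<lambda>y. X (cinv c y) c))"

section \<open>Spacetimes\<close>

text \<open>The last conjunct of the first clause says that the signature is \<open>(-,+,\<dots>,+)\<close>: there is an orthonormal
  family of \<open>DIM('e)\<close> tangent vectors, which is then a basis, exactly one of them negative.\<close>

definition lorentzian_metric ::
  "('m::topological_space, 'e::euclidean_space) chart set \<Rightarrow>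
   ('m \<Rightarrow> ('m, 'e) tvec \<Rightarrow> ('m, 'e) tvec \<Rightarrow> real) \<Rightarrow> bool" where
  "lorentzian_metric A g \<longleftrightarrow>
     (\<forall>p. symmetric_bilinear_on (tangent_space A p) (g p) \<and>
        (\<exists>E. \<exists>b0\<in>Basis. (\<forall>b\<in>Basis. E b \<in> tangent_space A p) \<and>
           (\<forall>b\<in>Basis. \<forall>b'\<in>Basis. g p (E b) (E b') =
              (if b \<noteq> b' then 0 else if (b::'e) = b0 then -1 else 1)))) \<and>
     (\<forall>c\<in>A. \<forall>u w. smooth_on (cran c)
        (\<lambda>y. g (cinv c y) (tvec_of A (cinv c y) c u) (tvec_of A (cinv c y) c w)))"

text \<open>The time orientation is given by a smooth timelike vector field \<open>T\<close>, declared to be future-directed.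
  A timelike vector is then future-directed iff it lies in the same time cone as \<open>T\<close>.\<close>

definition spacetime ::
  "('m::{t2_space,second_countable_topology}, 'e::euclidean_space) chart set \<Rightarrow>
   ('m \<Rightarrow> ('m, 'e) tvec \<Rightarrow> ('m, 'e) tvec \<Rightarrow> real) \<Rightarrow> ('m \<Rightarrow> ('m, 'e) tvec) \<Rightarrow> bool" where
  "spacetime A g T \<longleftrightarrow> DIM('e) \<ge> 2 \<and> connected (UNIV :: 'm set) \<and> smooth_structure A \<and>
     lorentzian_metric A g \<and> vector_field A T \<and> (\<forall>p. g p (T p) (T p) < 0)"

definition future_timelike ::
  "('m::topological_space, 'e::euclidean_space) chart set \<Rightarrow>
   ('m \<Rightarrow> ('m, 'e) tvec \<Rightarrow> ('m, 'e) tvec \<Rightarrow> real) \<Rightarrow> ('m \<Rightarrow> ('m, 'e) tvec) \<Rightarrow>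
   'm \<Rightarrow> ('m, 'e) tvec \<Rightarrow> bool" where
  "future_timelike A g T p v \<longleftrightarrow> v \<in> tangent_space A p \<and> g p v v < 0 \<and> g p v (T p) < 0"

definition smooth_curve_on ::
  "('m::topological_space, 'e::euclidean_space) chart set \<Rightarrow> real set \<Rightarrow> (real \<Rightarrow> 'm) \<Rightarrow> bool" where
  "smooth_curve_on A J \<gamma> \<longleftrightarrow> open J \<and> continuous_on J \<gamma> \<and>
     (\<forall>c\<in>A. smooth_on {t\<in>J. \<gamma> t \<in> cdom c} (cmap c \<circ> \<gamma>))"

definition velocity ::
  "('m::topological_space, 'e::euclidean_space) chart set \<Rightarrow> (real \<Rightarrow> 'm) \<Rightarrow> real \<Rightarrow> ('m, 'e) tvec" where
  "velocity A \<gamma> t = (\<lambda>c. if c \<in> A \<and> \<gamma> t \<in> cdom c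
      then vector_derivative (cmap c \<circ> \<gamma>) (at t) else 0)"

text \<open>Smoothness on a compact interval means smoothness on some open neighbourhood of it.\<close>

definition timelike_segment ::
  "('m::topological_space, 'e::euclidean_space) chart set \<Rightarrow>
   ('m \<Rightarrow> ('m, 'e) tvec \<Rightarrow> ('m, 'e) tvec \<Rightarrow> real) \<Rightarrow> ('m \<Rightarrow> ('m, 'e) tvec) \<Rightarrow> 'm \<Rightarrow> 'm \<Rightarrow> bool" where
  "timelike_segment A g T p q \<longleftrightarrow> (\<exists>\<gamma> a b J. a < b \<and> {a..b} \<subseteq> J \<and> smooth_curve_on A J \<gamma> \<and>
      (\<forall>t\<in>{a..b}. future_timelike A g T (\<gamma> t) (velocity A \<gamma> t)) \<and> \<gamma> a = p \<and> \<gamma> b = q)"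

text \<open>\<open>p \<lless> q\<close> iff a piecewise smooth future-directed timelike curve, i.e. a finite concatenation of
  smooth ones, runs from \<open>p\<close> to \<open>q\<close>.\<close>

definition chron_before ::
  "('m::topological_space, 'e::euclidean_space) chart set \<Rightarrow>
   ('m \<Rightarrow> ('m, 'e) tvec \<Rightarrow> ('m, 'e) tvec \<Rightarrow> real) \<Rightarrow> ('m \<Rightarrow> ('m, 'e) tvec) \<Rightarrow> 'm \<Rightarrow> 'm \<Rightarrow> bool" where
  "chron_before A g T = (timelike_segment A g T)\<^sup>+\<^sup>+"

definition chron_future ("I\<^sup>+") where
  "I\<^sup>+ A g T S = {q. \<exists>p\<in>S. chron_before A g T p q}"

definition chron_past ("I\<^sup>-") where
  "I\<^sup>- A g T S = {p. \<exists>q\<in>S. chron_before A g T p q}"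

section \<open>Integral curves, flows and omniscience\<close>

definition integral_curve ::
  "('m::topological_space, 'e::euclidean_space) chart set \<Rightarrow> ('m \<Rightarrow> ('m, 'e) tvec) \<Rightarrow>
   real set \<Rightarrow> (real \<Rightarrow> 'm) \<Rightarrow> bool" where
  "integral_curve A X J \<gamma> \<longleftrightarrow> open J \<and> is_interval J \<and> J \<noteq> {} \<and> continuous_on J \<gamma> \<and>
     (\<forall>t\<in>J. \<forall>c\<in>A. \<gamma> t \<in> cdom c \<longrightarrow> ((cmap c \<circ> \<gamma>) has_vector_derivative X (\<gamma> t) c) (at t))"

definition maximal_integral_curve ::
  "('m::topological_space, 'e::euclidean_space) chart set \<Rightarrow> ('m \<Rightarrow> ('m, 'e) tvec) \<Rightarrow>
   real set \<Rightarrow> (real \<Rightarrow> 'm) \<Rightarrow> bool" where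
  "maximal_integral_curve A X J \<gamma> \<longleftrightarrow> integral_curve A X J \<gamma> \<and>
     (\<forall>J' \<gamma>'. integral_curve A X J' \<gamma>' \<and> J \<subseteq> J' \<and> (\<forall>t\<in>J. \<gamma>' t = \<gamma> t) \<longrightarrow> J' = J)"

text \<open>\<open>\<phi>\<close> is a smooth \<open>\<real>\<close>-action whose orbits \<open>t \<mapsto> \<phi> t p\<close> are integral curves of \<open>X\<close>. Such a \<open>\<phi>\<close> is unique,
  and it exists iff all maximal integral curves of \<open>X\<close> are defined on the whole of \<open>\<real>\<close>; so this says that \<open>X\<close>
  is complete with flow \<open>\<phi>\<close>.\<close>

definition complete_with_flow ::
  "('m::topological_space, 'e::euclidean_space) chart set \<Rightarrow> ('m \<Rightarrow> ('m, 'e) tvec) \<Rightarrow>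
   (real \<Rightarrow> 'm \<Rightarrow> 'm) \<Rightarrow> bool" where
  "complete_with_flow A X \<phi> \<longleftrightarrow>
     continuous_on UNIV (\<lambda>(t, p). \<phi> t p) \<and>
     (\<forall>c\<in>A. \<forall>d\<in>A. smooth_on {(t, y). y \<in> cran c \<and> \<phi> t (cinv c y) \<in> cdom d}
        (\<lambda>(t, y). cmap d (\<phi> t (cinv c y)))) \<and>
     (\<forall>p. \<phi> 0 p = p) \<and> (\<forall>s t p. \<phi> (s + t) p = \<phi> s (\<phi> t p)) \<and>
     (\<forall>p. integral_curve A X UNIV (\<lambda>t. \<phi> t p))"

definition proper_action :: "(real \<Rightarrow> 'm::topological_space \<Rightarrow> 'm) \<Rightarrow> bool" where
  "proper_action \<phi> \<longleftrightarrow> proper_map euclidean euclidean (\<lambda>(t, p). (\<phi> t p, p))"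

definition integral_foliation ::
  "('m::topological_space, 'e::euclidean_space) chart set \<Rightarrow> ('m \<Rightarrow> ('m, 'e) tvec) \<Rightarrow> 'm set set" where
  "integral_foliation A X = {\<gamma> ` J | J \<gamma>. maximal_integral_curve A X J \<gamma>}"

definition future_omniscient where
  "future_omniscient A g T F \<longleftrightarrow> (\<forall>L\<in>F. I\<^sup>- A g T L = UNIV)"

definition past_omniscient where
  "past_omniscient A g T F \<longleftrightarrow> (\<forall>L\<in>F. I\<^sup>+ A g T L = UNIV)"

section \<open>Slices\<close>

text \<open>For hypersurfaces the model space is \<open>real \<times> 's\<close> with \<open>DIM('s) = n\<close>, and the model hypersurface is
  \<open>{0} \<times> 's\<close>.\<close>

definition slice_chart ::
  "('m::topological_space, real \<times> 's::euclidean_space) chart set \<Rightarrow> 'm set \<Rightarrow>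
   ('m, real \<times> 's) chart \<Rightarrow> bool" where
  "slice_chart A \<Sigma> c \<longleftrightarrow> c \<in> A \<and> cmap c ` (cdom c \<inter> \<Sigma>) = cran c \<inter> ({0} \<times> UNIV)"

definition hypersurface ::
  "('m::topological_space, real \<times> 's::euclidean_space) chart set \<Rightarrow> 'm set \<Rightarrow> bool" where
  "hypersurface A \<Sigma> \<longleftrightarrow> (\<forall>p\<in>\<Sigma>. \<exists>c. slice_chart A \<Sigma> c \<and> p \<in> cdom c)"

definition slice ::
  "('m::topological_space, real \<times> 's::euclidean_space) chart set \<Rightarrow>
   ('m \<Rightarrow> ('m, real \<times> 's) tvec) \<Rightarrow> 'm set \<Rightarrow> bool" where
  "slice A X \<Sigma> \<longleftrightarrow> hypersurface A \<Sigma> \<and>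
     (\<forall>J \<gamma>. maximal_integral_curve A X J \<gamma> \<longrightarrow> (\<exists>!t. t \<in> J \<and> \<gamma> t \<in> \<Sigma>))"

definition tangent_space_sub ::
  "('m::topological_space, real \<times> 's::euclidean_space) chart set \<Rightarrow> 'm set \<Rightarrow> 'm \<Rightarrow>
   ('m, real \<times> 's) tvec set" where
  "tangent_space_sub A \<Sigma> x =
     {v \<in> tangent_space A x. \<forall>c. slice_chart A \<Sigma> c \<and> x \<in> cdom c \<longrightarrow> fst (v c) = 0}"

definition one_form_sub ::
  "('m::topological_space, real \<times> 's::euclidean_space) chart set \<Rightarrow> 'm set \<Rightarrow>
   ('m \<Rightarrow> ('m, real \<times> 's) tvec \<Rightarrow> real) \<Rightarrow> bool" where
  "one_form_sub A \<Sigma> \<omega> \<longleftrightarrow>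
     (\<forall>x\<in>\<Sigma>. linear_form_on (tangent_space_sub A \<Sigma> x) (\<omega> x)) \<and>
     (\<forall>c u. slice_chart A \<Sigma> c \<longrightarrow> smooth_on {y. (0, y) \<in> cran c}
        (\<lambda>y. let x = cinv c (0, y) in \<omega> x (tvec_of A x c (0, u))))"

definition riemannian_metric_sub ::
  "('m::topological_space, real \<times> 's::euclidean_space) chart set \<Rightarrow> 'm set \<Rightarrow>
   ('m \<Rightarrow> ('m, real \<times> 's) tvec \<Rightarrow> ('m, real \<times> 's) tvec \<Rightarrow> real) \<Rightarrow> bool" where
  "riemannian_metric_sub A \<Sigma> h \<longleftrightarrow>
     (\<forall>x\<in>\<Sigma>. symmetric_bilinear_on (tangent_space_sub A \<Sigma> x) (h x) \<and>
        (\<forall>v\<in>tangent_space_sub A \<Sigma> x. v \<noteq> tzero \<longrightarrow> h x v v > 0)) \<and>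
     (\<forall>c u w. slice_chart A \<Sigma> c \<longrightarrow> smooth_on {y. (0, y) \<in> cran c}
        (\<lambda>y. let x = cinv c (0, y) in h x (tvec_of A x c (0, u)) (tvec_of A x c (0, w))))"

section \<open>Tameness\<close>

text \<open>The differential of \<open>\<phi> : \<real> \<times> M \<rightarrow> M\<close> at \<open>(\<tau>, x)\<close>, applied to \<open>(a, v) \<in> \<real> \<times> T\<^sub>xM\<close> and computed in an
  arbitrary chart \<open>c\<close> around \<open>x\<close>. For \<open>x \<in> \<Sigma>\<close> and \<open>v \<in> T\<^sub>x\<Sigma> \<subseteq> T\<^sub>xM\<close> it is the differential of \<open>\<phi>\<^sub>\<Sigma>\<close>.\<close>

definition flow_differential ::
  "('m::topological_space, 'e::euclidean_space) chart set \<Rightarrow> (real \<Rightarrow> 'm \<Rightarrow> 'm) \<Rightarrow> real \<Rightarrow> 'm \<Rightarrow>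
   real \<times> ('m, 'e) tvec \<Rightarrow> ('m, 'e) tvec" where
  "flow_differential A \<phi> \<tau> x av = (let c = (SOME c. c \<in> A \<and> x \<in> cdom c) in
     (\<lambda>d. if d \<in> A \<and> \<phi> \<tau> x \<in> cdom d
        then frechet_derivative (\<lambda>(t, y). cmap d (\<phi> t (cinv c y))) (at (\<tau>, cmap c x)) (fst av, snd av c)
        else 0))"

definition flow_pullback ::
  "('m::topological_space, 'e::euclidean_space) chart set \<Rightarrow>
   ('m \<Rightarrow> ('m, 'e) tvec \<Rightarrow> ('m, 'e) tvec \<Rightarrow> real) \<Rightarrow> (real \<Rightarrow> 'm \<Rightarrow> 'm) \<Rightarrow> real \<Rightarrow> 'm \<Rightarrow>
   real \<times> ('m, 'e) tvec \<Rightarrow> real \<times> ('m, 'e) tvec \<Rightarrow> real" where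
  "flow_pullback A g \<phi> \<tau> x av bw =
     g (\<phi> \<tau> x) (flow_differential A \<phi> \<tau> x av) (flow_differential A \<phi> \<tau> x bw)"

definition lapse where
  "lapse A g \<phi> \<tau> x = sqrt (- flow_pullback A g \<phi> \<tau> x (1, tzero) (1, tzero))"

definition shift_form where
  "shift_form A g \<phi> \<tau> x v = flow_pullback A g \<phi> \<tau> x (1, tzero) (0, v)"

definition slice_form where
  "slice_form A g \<phi> \<tau> x v w = flow_pullback A g \<phi> \<tau> x (0, v) (0, w)"

text \<open>The sign \<open>\<sigma> = 1\<close> gives the functions with superscript \<open>+\<close>, \<open>\<sigma> = -1\<close> those with superscript \<open>-\<close>.\<close>

definition F_flow where
  "F_flow \<sigma> A g \<phi> \<tau> x v =
     \<sigma> * (shift_form A g \<phi> \<tau> x v / lapse A g \<phi> \<tau> x) +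
     sqrt ((shift_form A g \<phi> \<tau> x v)\<^sup>2 / (lapse A g \<phi> \<tau> x)\<^sup>2 + slice_form A g \<phi> \<tau> x v v)"

definition F_ref where
  "F_ref \<sigma> \<omega>\<^sub>0 g\<^sub>0 x v = \<sigma> * \<omega>\<^sub>0 x v + sqrt ((\<omega>\<^sub>0 x v)\<^sup>2 + g\<^sub>0 x v v)"

definition tame_bound ::
  "real \<Rightarrow> ('m::topological_space, real \<times> 's::euclidean_space) chart set \<Rightarrow>
   ('m \<Rightarrow> ('m, real \<times> 's) tvec \<Rightarrow> ('m, real \<times> 's) tvec \<Rightarrow> real) \<Rightarrow>
   (real \<Rightarrow> 'm \<Rightarrow> 'm) \<Rightarrow> 'm set \<Rightarrow> (real \<Rightarrow> real) \<Rightarrow> bool" where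
  "tame_bound \<sigma> A g \<phi> \<Sigma> \<aa> \<longleftrightarrow>
     (\<exists>\<omega>\<^sub>0 g\<^sub>0. one_form_sub A \<Sigma> \<omega>\<^sub>0 \<and> riemannian_metric_sub A \<Sigma> g\<^sub>0 \<and>
        (\<forall>\<tau>. \<forall>x\<in>\<Sigma>. \<forall>v\<in>tangent_space_sub A \<Sigma> x.
           F_flow \<sigma> A g \<phi> \<tau> x v \<le> \<aa> \<tau> * lapse A g \<phi> \<tau> x * F_ref \<sigma> \<omega>\<^sub>0 g\<^sub>0 x v))"

text \<open>In the following two definitions \<open>\<phi>\<close> is meant to be the flow of \<open>X\<close>.\<close>

definition future_tame where
  "future_tame A g X \<phi> \<longleftrightarrow> proper_action \<phi> \<and>
     (\<exists>\<Sigma> \<aa>. slice A X \<Sigma> \<and> smooth_on UNIV \<aa> \<and> (\<forall>s. \<aa> s > 0) \<and> tame_bound 1 A g \<phi> \<Sigma> \<aa> \<and>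
        (\<integral>\<^sup>+s\<in>{0..}. ennreal (1 / \<aa> s) \<partial>lborel) = \<infinity>)"

definition past_tame where
  "past_tame A g X \<phi> \<longleftrightarrow> proper_action \<phi> \<and>
     (\<exists>\<Sigma> \<aa>. slice A X \<Sigma> \<and> smooth_on UNIV \<aa> \<and> (\<forall>s. \<aa> s > 0) \<and> tame_bound (-1) A g \<phi> \<Sigma> \<aa> \<and>
        (\<integral>\<^sup>+s\<in>{..0}. ennreal (1 / \<aa> s) \<partial>lborel) = \<infinity>)"

end

theory Submission
  imports Defs
begin

text \<open>Take two points of the slice joined by a straight segment in a slice chart, and let \<open>v\<close> be the velocity of
  the segment. If \<open>C\<close> exceeds the values \<open>F\<^sup>\<plusminus>(v)\<close> along the segment, then the lift \<open>\<tau> \<mapsto> \<phi> \<tau> (\<sigma>(f \<tau>))\<close> with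
  \<open>f' = \<plusminus> 1 / (C \<aa>)\<close> is future-directed timelike, because the tameness bound gives
  \<open>F\<^sup>\<plusminus>\<^sub>\<tau>(\<plusminus> f' v) < \<beta>\<close>; it traverses the whole segment because \<open>1 / \<aa>\<close> has infinite integral. So every
  point is chronologically before (after, for \<open>-\<close>) some point of each neighbouring flow line, and connectedness of \<open>M\<close> does the rest. A slice
  may be tangent to \<open>X\<close>, so \<open>\<real> \<times> \<Sigma> \<rightarrow> M\<close> need not be a diffeomorphism; that flowing out
  open subsets of the slice gives open sets follows from invariance of domain.\<close>

section \<open>Calculus of smooth functions\<close>

text \<open>The reference data on the slice need not be bounded, except on compact subsets, so no
  single \<open>C\<close> serves the whole slice. The comparison is therefore made on one chart
  segment at a time, with a \<open>C\<close> that depends on the segment. Such segments can be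
  chained because a lift may start at any time: \<open>1 / \<aa>\<close> has finite integral over a
  bounded interval, so what remains after any start still diverges.

  The condition \<open>F\<^sup>+(w) < \<beta>\<close> is the timelike condition in disguise: it is
  what completing the square makes of \<open>g(X + w, X + w) < 0\<close> together with
  \<open>g(X + w, X) < 0\<close>. The past case is the same argument run backwards in time. Since
  \<open>F\<^sup>-(-v) = F\<^sup>+(v)\<close>, a sign \<open>s\<close>, equal to \<open>1\<close> or
  \<open>-1\<close>, carries both cases through one proof.\<close>

lemma Ck_on_cong:
  assumes "open S" and "\<And>x. x \<in> S \<Longrightarrow> f x = g x"
  shows "Ck_on k S f \<longleftrightarrow> Ck_on k S g"
  using assms(2)
proof (induction k arbitrary: f g)
  case 0
  then show ?case using continuous_on_cong[of S S f g] by auto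
next
  case (Suc k)
  have imp: "Ck_on (Suc k) S g" if "Ck_on (Suc k) S f" and eq: "\<And>x. x \<in> S \<Longrightarrow> f x = g x" for f g :: "'a \<Rightarrow> 'b"
  proof -
    have df: "f differentiable (at x)" if "x \<in> S" for x using that \<open>Ck_on (Suc k) S f\<close> by simp
    have "g differentiable (at x)" if "x \<in> S" for x
      using df[OF that] has_derivative_transform_within_open[OF _ \<open>open S\<close> that, of f _ UNIV g] eq
      unfolding differentiable_def by blast
    moreover have "Ck_on k S (\<lambda>x. frechet_derivative g (at x) v)" for v
    proof -
      have "frechet_derivative f (at x) v = frechet_derivative g (at x) v" if "x \<in> S" for x
        using frechet_derivative_transform_within_open[OF df[OF that] \<open>open S\<close> that eq] by simp
      then show ?thesis using Suc.IH \<open>Ck_on (Suc k) S f\<close> by (metis (no_types, lifting) Ck_on.simps(2))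
    qed
    ultimately show ?thesis by simp
  qed
  show ?case using imp[of f g] imp[of g f] Suc.prems by metis
qed

lemma Ck_on_subset: "Ck_on k S f \<Longrightarrow> T \<subseteq> S \<Longrightarrow> Ck_on k T f"
  by (induction k arbitrary: f) (auto intro: continuous_on_subset)

lemma Ck_on_SucD: "Ck_on (Suc k) S f \<Longrightarrow> Ck_on k S f"
proof (induction k arbitrary: f)
  case 0
  then show ?case
    by (auto simp: continuous_on_eq_continuous_at differentiable_imp_continuous_within
        intro!: continuous_at_imp_continuous_on)
next
  case (Suc k)
  then show ?case by auto
qed

lemma Ck_on_SucI:
  assumes "open S" and "\<And>x. x \<in> S \<Longrightarrow> (f has_derivative f' x) (at x)"
    and "\<And>v. Ck_on k S (\<lambda>x. f' x v)"
  shows "Ck_on (Suc k) S f"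
proof -
  have "frechet_derivative f (at x) = f' x" if "x \<in> S" for x
    using frechet_derivative_at[OF assms(2)[OF that]] by simp
  then have "Ck_on k S (\<lambda>x. frechet_derivative f (at x) v)" for v
    using Ck_on_cong[OF \<open>open S\<close>, of "\<lambda>x. frechet_derivative f (at x) v" "\<lambda>x. f' x v" k] assms(3) by simp
  then show ?thesis using assms(2) by (auto simp: differentiable_def)
qed

lemma Ck_on_Suc_deriv:
  assumes "Ck_on (Suc k) S f" and "x \<in> S"
  shows "(f has_derivative frechet_derivative f (at x)) (at x)"
  using assms by (simp add: frechet_derivative_works)

lemma Ck_on_const: "open S \<Longrightarrow> Ck_on k S (\<lambda>_. c)"
proof (induction k arbitrary: c)
  case (Suc k)
  show ?case by (rule Ck_on_SucI[where f' = "\<lambda>_ _. 0"]) (use Suc in auto)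
qed simp

lemma Ck_on_bounded_linear:
  assumes "open S" and "bounded_linear f"
  shows "Ck_on k S f"
proof (cases k)
  case 0
  then show ?thesis using assms linear_continuous_on by auto
next
  case (Suc m)
  show ?thesis unfolding Suc
    by (rule Ck_on_SucI[where f' = "\<lambda>_. f"])
      (use assms Ck_on_const in \<open>auto intro: bounded_linear_imp_has_derivative\<close>)
qed

lemma Ck_on_add:
  assumes "open S" and "Ck_on k S f" and "Ck_on k S g"
  shows "Ck_on k S (\<lambda>x. f x + g x)"
  using assms(2,3)
proof (induction k arbitrary: f g)
  case 0
  then show ?case by (auto intro: continuous_on_add)
next
  case (Suc k)
  show ?case
    by (rule Ck_on_SucI[where f' = "\<lambda>x v. frechet_derivative f (at x) v + frechet_derivative g (at x) v"])
      (use Suc assms(1) in \<open>auto intro!: has_derivative_add Ck_on_Suc_deriv\<close>)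
qed

lemma Ck_on_sum:
  assumes "open S" and "finite I" and "\<And>i. i \<in> I \<Longrightarrow> Ck_on k S (f i)"
  shows "Ck_on k S (\<lambda>x. \<Sum>i\<in>I. f i x)"
  using assms(2,3)
  by (induction I rule: finite_induct) (auto intro: Ck_on_const Ck_on_add assms(1))

lemma Ck_on_bilinear:
  assumes "open S" and "bounded_bilinear B" and "Ck_on k S f" and "Ck_on k S g"
  shows "Ck_on k S (\<lambda>x. B (f x) (g x))"
  using assms(3,4)
proof (induction k arbitrary: f g)
  case 0
  then show ?case using bounded_bilinear.continuous_on[OF assms(2)] by auto
next
  case (Suc k)
  have "Ck_on k S (\<lambda>x. B (f x) (frechet_derivative g (at x) v) + B (frechet_derivative f (at x) v) (g x))" for v
    using Suc.prems Ck_on_SucD[of k S f] Ck_on_SucD[of k S g]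
    by (intro Ck_on_add[OF assms(1)] Suc.IH) auto
  moreover have "((\<lambda>x. B (f x) (g x)) has_derivative (\<lambda>v. B (f x) (frechet_derivative g (at x) v) +
      B (frechet_derivative f (at x) v) (g x))) (at x)" if "x \<in> S" for x
    by (rule bounded_bilinear.FDERIV[OF assms(2)]) (use Suc.prems that Ck_on_Suc_deriv in blast)+
  ultimately show ?case by (intro Ck_on_SucI[OF assms(1)])
qed

text \<open>The chain rule evaluates the derivative of \<open>g\<close> in the direction
  \<open>?f' x v\<close>, which varies with \<open>x\<close>, whereas \<open>Ck_on\<close> only
  controls fixed directions. Expanding that direction in the basis of the Euclidean space
  \<open>'b\<close> reduces to fixed directions with scalar coefficients, to which the induction
  hypothesis and the product rule apply.\<close>

lemma Ck_on_compose:
  fixes f :: "'a::real_normed_vector \<Rightarrow> 'b::euclidean_space"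
  assumes "open S" and "Ck_on k S f" and "Ck_on k T g" and "f ` S \<subseteq> T"
  shows "Ck_on k S (\<lambda>x. g (f x))"
  using assms(2,3)
proof (induction k arbitrary: g)
  case 0
  then show ?case using continuous_on_compose2[of T g S f] assms(4) by auto
next
  case (Suc k)
  let ?f' = "\<lambda>x. frechet_derivative f (at x)"
  let ?g' = "\<lambda>x. frechet_derivative g (at x)"
  have deriv: "((\<lambda>x. g (f x)) has_derivative (\<lambda>v. ?g' (f x) (?f' x v))) (at x)" if "x \<in> S" for x
    using has_derivative_compose[OF Ck_on_Suc_deriv[OF Suc.prems(1) that]
        Ck_on_Suc_deriv[OF Suc.prems(2), of "f x"]] that assms(4) by auto
  have expand: "?g' (f x) (?f' x v) = (\<Sum>b\<in>Basis. (?f' x v \<bullet> b) *\<^sub>R ?g' (f x) b)" if "x \<in> S" for x v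
  proof -
    have "linear (?g' (f x))"
      using Ck_on_Suc_deriv[OF Suc.prems(2), of "f x"] that assms(4) has_derivative_linear by blast
    then have "?g' (f x) (\<Sum>b\<in>Basis. (?f' x v \<bullet> b) *\<^sub>R b) = (\<Sum>b\<in>Basis. (?f' x v \<bullet> b) *\<^sub>R ?g' (f x) b)"
      by (simp add: linear_sum linear_scale)
    then show ?thesis by (simp add: euclidean_representation)
  qed
  have "Ck_on k S (\<lambda>x. \<Sum>b\<in>Basis. (?f' x v \<bullet> b) *\<^sub>R ?g' (f x) b)" for v
    using Suc Ck_on_SucD[of k S f]
    by (intro Ck_on_sum Ck_on_bilinear[OF _ bounded_bilinear_scaleR]
        Ck_on_bilinear[OF _ bounded_bilinear_inner] Ck_on_const assms(1) Suc.IH) auto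
  then have "Ck_on k S (\<lambda>x. ?g' (f x) (?f' x v))" for v
    using Ck_on_cong[OF assms(1) expand, of "\<lambda>x. x"] by simp
  then show ?case using Ck_on_SucI[OF assms(1) deriv] by blast
qed

lemma Ck_on_Pair:
  assumes "open S" and "Ck_on k S f" and "Ck_on k S g"
  shows "Ck_on k S (\<lambda>x. (f x, g x))"
  using assms(2,3)
proof (induction k arbitrary: f g)
  case 0
  then show ?case by (auto intro: continuous_on_Pair)
next
  case (Suc k)
  then show ?case
    by (intro Ck_on_SucI[OF assms(1), where f' = "\<lambda>x v. (frechet_derivative f (at x) v, frechet_derivative g (at x) v)"])
      (auto intro!: has_derivative_Pair simp: frechet_derivative_works)
qed

lemma Ck_on_inverse:
  fixes f :: "'a::real_normed_vector \<Rightarrow> real"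
  assumes "open S" and "Ck_on k S f" and nz: "\<And>x. x \<in> S \<Longrightarrow> f x \<noteq> 0"
  shows "Ck_on k S (\<lambda>x. inverse (f x))"
  using assms(2)
proof (induction k)
  case 0
  then show ?case using nz by (auto intro: continuous_on_inverse)
next
  case (Suc k)
  let ?f' = "\<lambda>x. frechet_derivative f (at x)"
  have IH: "Ck_on k S (\<lambda>x. inverse (f x))" using Suc Ck_on_SucD by blast
  have "Ck_on k S (\<lambda>x. (-1) * ((inverse (f x) * ?f' x v) * inverse (f x)))" for v
    using Suc.prems
    by (intro Ck_on_bilinear[OF _ bounded_bilinear_mult] IH Ck_on_const assms(1)) auto
  then have 1: "Ck_on k S (\<lambda>x. - (inverse (f x) * ?f' x v * inverse (f x)))" for v by simp
  have 2: "((\<lambda>x. inverse (f x)) has_derivative (\<lambda>v. - (inverse (f x) * ?f' x v * inverse (f x)))) (at x)"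
    if "x \<in> S" for x
    using Deriv.has_derivative_inverse[OF nz[OF that] Ck_on_Suc_deriv[OF Suc.prems that]] .
  show ?case using Ck_on_SucI[OF assms(1) 2 1] .
qed

lemma Ck_on_antiderivative:
  fixes G :: "real \<Rightarrow> real"
  assumes "open S" and "\<And>x. x \<in> S \<Longrightarrow> (G has_real_derivative h x) (at x)" and "Ck_on k S h"
  shows "Ck_on k S G"
proof -
  have "Ck_on k S (\<lambda>x. h x * v)" for v
    using Ck_on_bilinear[OF assms(1) bounded_bilinear_mult assms(3) Ck_on_const[OF assms(1)]] .
  then have "Ck_on (Suc k) S G"
    using assms(2) by (intro Ck_on_SucI[OF assms(1)]) (auto simp: has_field_derivative_def)
  then show ?thesis by (rule Ck_on_SucD)
qed

lemma smooth_on_has_derivative: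
  assumes "smooth_on S f" and "x \<in> S"
  shows "(f has_derivative frechet_derivative f (at x)) (at x)"
  using assms Ck_on_Suc_deriv unfolding smooth_on_def by blast

lemma smooth_on_continuous_on: "smooth_on S f \<Longrightarrow> continuous_on S f"
  unfolding smooth_on_def by (metis Ck_on.simps(1))

section \<open>Divergent integrals and the Minkowski form\<close>

lemma antiderivative_real_line:
  fixes f :: "real \<Rightarrow> real"
  assumes "continuous_on UNIV f"
  obtains G where "\<And>x. (G has_real_derivative f x) (at x)"
proof -
  have "isCont f x" for x using assms by (simp add: continuous_on_eq_continuous_at)
  then obtain G where "\<forall>x. (G has_vector_derivative f x) (at x)"
    using einterval_antiderivative[of "-\<infinity>" "\<infinity>" f] by auto
  then show ?thesis using that by (auto simp: has_real_derivative_iff_has_vector_derivative)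
qed

text \<open>If \<open>G\<close> stayed below \<open>G t0 + C\<close>, it would be bounded and
  monotone, hence convergent, and the integral of \<open>f\<close> over the half-line would be the
  finite number \<open>(SUP t. G t) - G 0\<close>. So \<open>G\<close> exceeds the level, and the
  intermediate value theorem finds the time at which it is attained. The start \<open>t0\<close> is
  unrelated to the endpoint \<open>0\<close> of the integral.\<close>

lemma antiderivative_reaches:
  fixes f :: "real \<Rightarrow> real"
  assumes G: "\<And>x. (G has_real_derivative f x) (at x)"
    and pos: "\<And>x. f x > 0" and cont: "continuous_on UNIV f"
    and inf: "(\<integral>\<^sup>+s\<in>{0..}. ennreal (f s) \<partial>lborel) = \<infinity>" and "C > 0"
  obtains t where "t > t0" and "G t - G t0 = C"
proof -
  have contG: "continuous_on S G" for S
    using G by (meson DERIV_isCont continuous_at_imp_continuous_on)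
  have mono: "mono G"
  proof (rule monoI)
    fix x y :: real assume "x \<le> y"
    then show "G x \<le> G y"
      by (rule DERIV_nonneg_imp_nondecreasing) (use G pos less_imp_le in blast)
  qed
  have "\<exists>t. G t \<ge> G t0 + C"
  proof (rule ccontr)
    assume "\<nexists>t. G t \<ge> G t0 + C"
    then have bd: "G t \<le> G t0 + C" for t by (meson linear)
    have "(G \<longlongrightarrow> (SUP t. G t)) at_top"
    proof (rule order_tendstoI)
      have bdd: "bdd_above (range G)" using bd by (auto simp: bdd_above_def)
      show "\<forall>\<^sub>F x in at_top. y < G x" if y: "y < (SUP t. G t)" for y
      proof -
        obtain t where "y < G t" using less_cSUP_iff[of UNIV G y] y bdd by auto
        then show ?thesis
          unfolding eventually_at_top_linorder using less_le_trans[OF _ monoD[OF mono]] by blast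
      qed
      show "\<forall>\<^sub>F x in at_top. G x < y" if "(SUP t. G t) < y" for y
        by (intro always_eventually allI le_less_trans[OF cSUP_upper[OF UNIV_I bdd] that])
    qed
    then have "(\<integral>\<^sup>+x. ennreal (f x) * indicator {0..} x \<partial>lborel) = ennreal ((SUP t. G t) - G 0)"
      using cont G pos by (intro nn_integral_FTC_atLeast)
        (simp_all add: borel_measurable_continuous_onI less_imp_le)
    then show False using inf by simp
  qed
  then obtain t1 where t1: "G t0 + C \<le> G t1" by blast
  then have "t0 < t1" using monoD[OF mono, of t1 t0] \<open>C > 0\<close> by (cases "t1 \<le> t0") auto
  then obtain t where t: "t0 \<le> t" "t \<le> t1" "G t = G t0 + C"
    using IVT'[of G t0 "G t0 + C" t1] t1 \<open>C > 0\<close> contG by auto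
  then have "t \<noteq> t0" using \<open>C > 0\<close> by auto
  with t that[of t] show ?thesis by auto
qed

text \<open>Reflection in the origin: \<open>- G (- x)\<close> is an antiderivative of
  \<open>f (- x)\<close>, so the forward version applies.\<close>

lemma antiderivative_reaches_left:
  fixes f :: "real \<Rightarrow> real"
  assumes G: "\<And>x. (G has_real_derivative f x) (at x)"
    and pos: "\<And>x. f x > 0" and cont: "continuous_on UNIV f"
    and inf: "(\<integral>\<^sup>+s\<in>{..0}. ennreal (f s) \<partial>lborel) = \<infinity>" and "C > 0"
  obtains t where "t < t0" and "G t0 - G t = C"
proof -
  have meas: "f \<in> borel_measurable borel" using cont by (rule borel_measurable_continuous_onI)
  have "((\<lambda>x. - G (- x)) has_real_derivative f (- x)) (at x)" for x
    using DERIV_minus[OF DERIV_chain2[OF G DERIV_minus[OF DERIV_ident], of x UNIV]] by simp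
  moreover have "continuous_on UNIV (\<lambda>x. f (- x))"
    using continuous_on_compose2[OF cont, of UNIV uminus] by (simp add: continuous_on_minus)
  moreover have "(\<integral>\<^sup>+s\<in>{0..}. ennreal (f (- s)) \<partial>lborel) = \<infinity>"
  proof -
    have "(\<integral>\<^sup>+s\<in>{..0}. ennreal (f s) \<partial>lborel) =
        (\<integral>\<^sup>+s. ennreal (f (- s)) * indicator {..0} (- s) \<partial>lborel)"
      using nn_integral_real_affine[of "\<lambda>s. ennreal (f s) * indicator {..0} s" "-1" 0] meas by simp
    moreover have "indicator {..0} (- s) = (indicator {0..} s :: ennreal)" for s :: real
      by (simp add: indicator_def)
    ultimately show ?thesis using inf by simp
  qed
  ultimately obtain t where "t > - t0" "- G (- t) - (- G (- (- t0))) = C"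
    using antiderivative_reaches[of "\<lambda>x. - G (- x)" "\<lambda>x. f (- x)" C "- t0"] pos \<open>C > 0\<close> by blast
  then show ?thesis using that[of "- t"] by auto
qed

text \<open>For a unit vector \<open>e\<close>, the form \<open>u \<bullet> w - 2 (u \<bullet> e) (w \<bullet> e)\<close> is the Minkowski product with time axis \<open>e\<close>.\<close>

definition minkowski :: "'a::real_inner \<Rightarrow> 'a \<Rightarrow> 'a \<Rightarrow> real" where
  "minkowski e u w = u \<bullet> w - 2 * (u \<bullet> e) * (w \<bullet> e)"

lemma minkowski_split:
  assumes "norm e = 1"
  shows "minkowski e u w = (u - (u \<bullet> e) *\<^sub>R e) \<bullet> (w - (w \<bullet> e) *\<^sub>R e) - (u \<bullet> e) * (w \<bullet> e)"
proof -
  have "e \<bullet> e = 1" using assms by (simp add: norm_eq_1)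
  then show ?thesis unfolding minkowski_def
    by (simp add: inner_diff_left inner_diff_right inner_commute algebra_simps)
qed

text \<open>If \<open>w\<close> is not timelike, the left side is at most \<open>0\<close>.
  Otherwise let \<open>a\<close>, \<open>b\<close> be the spatial lengths and \<open>c\<close>,
  \<open>d\<close> the absolute time components. The Euclidean Cauchy-Schwarz inequality bounds the
  product from below by \<open>c * d - a * b\<close>, which is nonnegative, and the rest is an
  identity between squares.\<close>

lemma minkowski_reverse_Cauchy_Schwarz:
  assumes e: "norm e = 1" and neg: "minkowski e u u < 0"
  shows "minkowski e u u * minkowski e w w \<le> (minkowski e u w)\<^sup>2"
proof (cases "minkowski e w w < 0")
  case False
  then have "minkowski e u u * minkowski e w w \<le> 0" using neg by (simp add: mult_le_0_iff)
  then show ?thesis by (smt (verit) zero_le_power2)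
next
  case True
  define a b c d where "a = norm (u - (u \<bullet> e) *\<^sub>R e)" and "b = norm (w - (w \<bullet> e) *\<^sub>R e)"
    and "c = \<bar>u \<bullet> e\<bar>" and "d = \<bar>w \<bullet> e\<bar>"
  have uu: "minkowski e u u = a\<^sup>2 - c\<^sup>2" and ww: "minkowski e w w = b\<^sup>2 - d\<^sup>2"
    unfolding minkowski_split[OF e] a_def b_def c_def d_def
    by (simp_all add: power2_norm_eq_inner power2_eq_square[of "_ \<bullet> _"])
  have nonneg: "a \<ge> 0" "b \<ge> 0" "c \<ge> 0" "d \<ge> 0" by (auto simp: a_def b_def c_def d_def)
  have "a \<le> c" "b \<le> d" using neg True uu ww nonneg by (auto intro: power2_le_imp_le[OF less_imp_le])
  then have le: "a * b \<le> c * d" using nonneg by (simp add: mult_mono)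
  have "\<bar>(u - (u \<bullet> e) *\<^sub>R e) \<bullet> (w - (w \<bullet> e) *\<^sub>R e)\<bar> \<le> a * b"
    unfolding a_def b_def by (rule Cauchy_Schwarz_ineq2)
  moreover have "\<bar>(u \<bullet> e) * (w \<bullet> e)\<bar> = c * d" by (simp add: c_def d_def abs_mult)
  ultimately have "c * d - a * b \<le> \<bar>minkowski e u w\<bar>" unfolding minkowski_split[OF e] by linarith
  then have "(c * d - a * b)\<^sup>2 \<le> (minkowski e u w)\<^sup>2"
    using le by (metis abs_le_square_iff abs_of_nonneg diff_ge_0_iff_ge)
  \<comment> \<open>The two sides differ by exactly the square of
    \<open>a * d - b * c\<close>.\<close>
  moreover have "(a\<^sup>2 - c\<^sup>2) * (b\<^sup>2 - d\<^sup>2) \<le> (c * d - a * b)\<^sup>2"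
    using zero_le_power2[of "a * d - b * c"] by (simp add: power2_eq_square algebra_simps)
  ultimately show ?thesis unfolding uu ww by linarith
qed

text \<open>For timelike vectors the spatial part of the product is strictly smaller in absolute
  value than the time part, so the sign is read off from the time components. Transitivity of the
  time cone thereby becomes a rule of signs.\<close>

lemma minkowski_neg_iff:
  assumes e: "norm e = 1" and "minkowski e u u < 0" and "minkowski e w w < 0"
  shows "minkowski e u w < 0 \<longleftrightarrow> (u \<bullet> e) * (w \<bullet> e) > 0"
proof -
  define a b c d where "a = norm (u - (u \<bullet> e) *\<^sub>R e)" and "b = norm (w - (w \<bullet> e) *\<^sub>R e)"
    and "c = \<bar>u \<bullet> e\<bar>" and "d = \<bar>w \<bullet> e\<bar>"
  have uu: "minkowski e u u = a\<^sup>2 - c\<^sup>2" and ww: "minkowski e w w = b\<^sup>2 - d\<^sup>2"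
    unfolding minkowski_split[OF e] a_def b_def c_def d_def
    by (simp_all add: power2_norm_eq_inner power2_eq_square[of "_ \<bullet> _"])
  have nonneg: "a \<ge> 0" "b \<ge> 0" "c \<ge> 0" "d \<ge> 0" by (auto simp: a_def b_def c_def d_def)
  have "a < c" "b < d" using assms(2,3) uu ww nonneg by (auto intro: power2_less_imp_less)
  then have less: "a * b < c * d" using nonneg by (simp add: mult_strict_mono')
  have "\<bar>(u - (u \<bullet> e) *\<^sub>R e) \<bullet> (w - (w \<bullet> e) *\<^sub>R e)\<bar> \<le> a * b"
    unfolding a_def b_def by (rule Cauchy_Schwarz_ineq2)
  moreover have "\<bar>(u \<bullet> e) * (w \<bullet> e)\<bar> = c * d" by (simp add: c_def d_def abs_mult)
  ultimately show ?thesis using less unfolding minkowski_split[OF e] by linarith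
qed

lemma minkowski_time_cone:
  assumes e: "norm e = 1" and neg: "minkowski e u u < 0" "minkowski e v v < 0" "minkowski e w w < 0"
    and "minkowski e u v < 0" "minkowski e v w < 0"
  shows "minkowski e u w < 0"
  using assms(5,6) unfolding minkowski_neg_iff[OF e neg(1,2)] minkowski_neg_iff[OF e neg(2,3)]
    minkowski_neg_iff[OF e neg(1,3)] by (auto simp: zero_less_mult_iff)

lemma minkowski_basis_representation:
  fixes u w :: "'a::euclidean_space"
  assumes "e \<in> Basis"
  shows "minkowski e u w = (\<Sum>b\<in>Basis. (u \<bullet> b) * (w \<bullet> b) * (if b = e then -1 else 1))"
proof -
  have "(\<Sum>b\<in>Basis. (u \<bullet> b) * (w \<bullet> b) * (if b = e then -1 else 1)) =
      (\<Sum>b\<in>Basis. (u \<bullet> b) * (w \<bullet> b) - (if b = e then 2 * (u \<bullet> e) * (w \<bullet> e) else 0))"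
    by (rule sum.cong) auto
  also have "\<dots> = minkowski e u w"
    using assms by (simp add: sum_subtractf minkowski_def euclidean_inner[of u w])
  finally show ?thesis by simp
qed

section \<open>Tangent vectors and velocities\<close>

locale smooth_manifold =
  fixes A :: "('m::t2_space, 'e::euclidean_space) chart set"
  assumes smooth_structure: "smooth_structure A"
begin

lemma chart_at: obtains c where "c \<in> A" and "p \<in> cdom c"
proof -
  have "p \<in> (\<Union>c\<in>A. cdom c)" using smooth_structure unfolding smooth_structure_def by simp
  then show ?thesis using that by blast
qed

lemma
  assumes "c \<in> A"
  shows open_cdom: "open (cdom c)" and open_cran: "open (cran c)"
    and homeomorphism_chart: "homeomorphism (cdom c) (cran c) (cmap c) (cinv c)"
proof -
  have "is_chart c" using smooth_structure assms unfolding smooth_structure_def by blast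
  then show "open (cdom c)" "open (cran c)" "homeomorphism (cdom c) (cran c) (cmap c) (cinv c)"
    unfolding is_chart_def by blast+
qed

lemma
  assumes "c \<in> A"
  shows cinv_cmap: "p \<in> cdom c \<Longrightarrow> cinv c (cmap c p) = p"
    and cmap_cinv: "y \<in> cran c \<Longrightarrow> cmap c (cinv c y) = y"
    and cinv_in_cdom: "y \<in> cran c \<Longrightarrow> cinv c y \<in> cdom c"
    and continuous_on_cmap: "continuous_on (cdom c) (cmap c)"
    and continuous_on_cinv: "continuous_on (cran c) (cinv c)"
  using homeomorphism_chart[OF assms] unfolding homeomorphism_def by auto

lemma transition_has_derivative:
  assumes "c \<in> A" "d \<in> A" "p \<in> cdom c" "p \<in> cdom d"
  shows "((cmap d \<circ> cinv c) has_derivative frechet_derivative (cmap d \<circ> cinv c) (at (cmap c p))) (at (cmap c p))"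
proof (rule smooth_on_has_derivative)
  show "smooth_on (cmap c ` (cdom c \<inter> cdom d)) (cmap d \<circ> cinv c)"
    using smooth_structure assms unfolding smooth_structure_def smooth_compatible_def by blast
qed (use assms in auto)

lemma transition_linear:
  assumes "c \<in> A" "d \<in> A" "p \<in> cdom c" "p \<in> cdom d"
  shows "linear (frechet_derivative (cmap d \<circ> cinv c) (at (cmap c p)))"
  using transition_has_derivative[OF assms] by (rule has_derivative_linear)

lemma tangent_spaceD:
  assumes "v \<in> tangent_space A p" "c \<in> A" "d \<in> A" "p \<in> cdom c" "p \<in> cdom d"
  shows "v d = frechet_derivative (cmap d \<circ> cinv c) (at (cmap c p)) (v c)"
  using assms unfolding tangent_space_def by blast

lemma tangent_space_outside:
  assumes "v \<in> tangent_space A p" "\<not> (c \<in> A \<and> p \<in> cdom c)"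
  shows "v c = 0"
  using assms unfolding tangent_space_def by blast

lemma tangent_space_lincomb:
  assumes "u \<in> tangent_space A p" "v \<in> tangent_space A p"
  shows "lincomb a u b v \<in> tangent_space A p"
proof -
  have "lincomb a u b v d = frechet_derivative (cmap d \<circ> cinv c) (at (cmap c p)) (lincomb a u b v c)"
    if cd: "c \<in> A" "d \<in> A" "p \<in> cdom c \<inter> cdom d" for c d
    using transition_linear[of c d p] tangent_spaceD[OF assms(1), of c d]
      tangent_spaceD[OF assms(2), of c d] cd
    by (simp add: lincomb_def linear_add linear_scale)
  moreover have "lincomb a u b v d = 0" if "\<not> (d \<in> A \<and> p \<in> cdom d)" for d
    using tangent_space_outside[OF assms(1) that] tangent_space_outside[OF assms(2) that]
    by (simp add: lincomb_def)
  ultimately show ?thesis unfolding tangent_space_def by blast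
qed

lemma tzero_in_tangent_space: "tzero \<in> tangent_space A p"
  unfolding tangent_space_def tzero_def by (auto simp: linear_0[OF transition_linear])

lemma tangent_space_eqI:
  assumes "u \<in> tangent_space A p" "v \<in> tangent_space A p" "c \<in> A" "p \<in> cdom c" "u c = v c"
  shows "u = v"
proof
  fix d show "u d = v d"
    using tangent_spaceD[OF assms(1,3), of d] tangent_spaceD[OF assms(2,3), of d] assms(4,5)
      tangent_space_outside[OF assms(1), of d] tangent_space_outside[OF assms(2), of d]
    by (cases "d \<in> A \<and> p \<in> cdom d") auto
qed

text \<open>Tangent vectors are families of components rather than elements of a vector space type,
  so linearity over finite sums, needed to expand \<open>g\<close> in an orthonormal frame, has to
  be derived from \<open>lincomb\<close>.\<close>

lemma linear_form_on_sum:
  assumes "linear_form_on (tangent_space A p) f" "finite I" "\<And>b. b \<in> I \<Longrightarrow> E b \<in> tangent_space A p"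
  shows "(\<lambda>d. \<Sum>b\<in>I. a b *\<^sub>R E b d) \<in> tangent_space A p \<and>
    f (\<lambda>d. \<Sum>b\<in>I. a b *\<^sub>R E b d) = (\<Sum>b\<in>I. a b * f (E b))"
  using assms(2,3)
proof (induction I rule: finite_induct)
  case empty
  have "f (lincomb 0 tzero 0 tzero) = 0"
    using assms(1) tzero_in_tangent_space unfolding linear_form_on_def by force
  then show ?case using tzero_in_tangent_space by (simp add: lincomb_def tzero_def)
next
  case (insert b I)
  let ?s = "\<lambda>d. \<Sum>b\<in>I. a b *\<^sub>R E b d"
  have eq: "(\<lambda>d. \<Sum>b\<in>insert b I. a b *\<^sub>R E b d) = lincomb (a b) (E b) 1 ?s"
    using insert.hyps by (simp add: lincomb_def)
  have "?s \<in> tangent_space A p" "f ?s = (\<Sum>b\<in>I. a b * f (E b))" "E b \<in> tangent_space A p"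
    using insert by auto
  then show ?case
    using assms(1) insert.hyps tangent_space_lincomb unfolding eq linear_form_on_def by simp
qed

section \<open>Velocities of curves and change of chart\<close>

lemma curve_change_chart:
  assumes "isCont \<gamma> t" "c \<in> A" "d \<in> A" "\<gamma> t \<in> cdom c" "\<gamma> t \<in> cdom d"
    and "((cmap c \<circ> \<gamma>) has_vector_derivative w) (at t)"
  shows "((cmap d \<circ> \<gamma>) has_vector_derivative
    frechet_derivative (cmap d \<circ> cinv c) (at (cmap c (\<gamma> t))) w) (at t)"
proof -
  have "\<forall>\<^sub>F s in at t. \<gamma> s \<in> cdom c"
    using assms(1,2,4) open_cdom unfolding isCont_def tendsto_def by blast
  then have ev: "\<forall>\<^sub>F s in at t. (cmap d \<circ> cinv c) ((cmap c \<circ> \<gamma>) s) = (cmap d \<circ> \<gamma>) s"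
    by eventually_elim (simp add: cinv_cmap assms)
  have "((cmap d \<circ> cinv c) has_derivative
      frechet_derivative (cmap d \<circ> cinv c) (at (cmap c (\<gamma> t)))) (at ((cmap c \<circ> \<gamma>) t))"
    using transition_has_derivative[OF assms(2-5)] by simp
  from has_derivative_compose[OF assms(6)[unfolded has_vector_derivative_def] this]
  have "((\<lambda>s. (cmap d \<circ> cinv c) ((cmap c \<circ> \<gamma>) s)) has_derivative
    (\<lambda>h. frechet_derivative (cmap d \<circ> cinv c) (at (cmap c (\<gamma> t))) (h *\<^sub>R w))) (at t)" .
  then have "((\<lambda>s. (cmap d \<circ> cinv c) ((cmap c \<circ> \<gamma>) s)) has_vector_derivative
    frechet_derivative (cmap d \<circ> cinv c) (at (cmap c (\<gamma> t))) w) (at t)"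
    unfolding has_vector_derivative_def using transition_linear[OF assms(2-5)]
    by (simp add: linear_scale)
  then show ?thesis
    unfolding has_vector_derivative_def
    by (rule has_derivative_transform_eventually[OF _ ev]) (simp_all add: cinv_cmap assms(2,4))
qed

lemma velocity_eq_tvec_of:
  assumes "isCont \<gamma> t" "c \<in> A" "\<gamma> t \<in> cdom c"
    and "((cmap c \<circ> \<gamma>) has_vector_derivative w) (at t)"
  shows "velocity A \<gamma> t = tvec_of A (\<gamma> t) c w"
proof
  fix d show "velocity A \<gamma> t d = tvec_of A (\<gamma> t) c w d"
    using vector_derivative_at[OF curve_change_chart[OF assms(1,2) _ assms(3) _ assms(4), of d]]
    by (simp add: velocity_def tvec_of_def)
qed

lemma velocity_chart:
  assumes "c \<in> A" "\<gamma> t \<in> cdom c" "((cmap c \<circ> \<gamma>) has_vector_derivative w) (at t)"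
  shows "velocity A \<gamma> t c = w"
  using assms(1,2) vector_derivative_at[OF assms(3)] by (simp add: velocity_def)

lemma velocity_in_tangent_space:
  assumes "isCont \<gamma> t" "c \<in> A" "\<gamma> t \<in> cdom c"
    and "((cmap c \<circ> \<gamma>) has_vector_derivative w) (at t)"
  shows "velocity A \<gamma> t \<in> tangent_space A (\<gamma> t)"
proof -
  have "velocity A \<gamma> t d = frechet_derivative (cmap d \<circ> cinv c') (at (cmap c' (\<gamma> t))) (velocity A \<gamma> t c')"
    if cd: "c' \<in> A" "d \<in> A" "\<gamma> t \<in> cdom c' \<inter> cdom d" for c' d
  proof -
    obtain w' where w': "((cmap c' \<circ> \<gamma>) has_vector_derivative w') (at t)"
      using curve_change_chart[OF assms(1,2) cd(1) assms(3) _ assms(4)] cd by blast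
    show ?thesis
      using velocity_chart[OF cd(1) _ w'] velocity_chart[OF cd(2) _ curve_change_chart[OF assms(1) cd(1,2) _ _ w']] cd
      by simp
  qed
  moreover have "velocity A \<gamma> t d = 0" if "\<not> (d \<in> A \<and> \<gamma> t \<in> cdom d)" for d
    using that by (auto simp: velocity_def)
  ultimately show ?thesis unfolding tangent_space_def by blast
qed

end

section \<open>Time cones\<close>

locale lorentzian_spacetime = smooth_manifold A
  for A :: "('m::{t2_space,second_countable_topology}, 'e::euclidean_space) chart set" +
  fixes g :: "'m \<Rightarrow> ('m, 'e) tvec \<Rightarrow> ('m, 'e) tvec \<Rightarrow> real"
    and T :: "'m \<Rightarrow> ('m, 'e) tvec"
  assumes spacetime: "spacetime A g T"
begin

lemma metric_bilinear: "symmetric_bilinear_on (tangent_space A p) (g p)"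
  using spacetime unfolding spacetime_def lorentzian_metric_def by blast

lemma metric_symmetric:
  "u \<in> tangent_space A p \<Longrightarrow> v \<in> tangent_space A p \<Longrightarrow> g p u v = g p v u"
  using metric_bilinear unfolding symmetric_bilinear_on_def by blast

lemma metric_linear_form: "u \<in> tangent_space A p \<Longrightarrow> linear_form_on (tangent_space A p) (g p u)"
  using metric_bilinear unfolding symmetric_bilinear_on_def by blast

lemma metric_lincomb_right:
  assumes "u \<in> tangent_space A p" "v \<in> tangent_space A p" "w \<in> tangent_space A p"
  shows "g p u (lincomb a v b w) = a * g p u v + b * g p u w"
  using metric_linear_form[OF assms(1)] assms unfolding linear_form_on_def by blast

lemma metric_lincomb_left:
  assumes "u \<in> tangent_space A p" "v \<in> tangent_space A p" "w \<in> tangent_space A p"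
  shows "g p (lincomb a v b w) u = a * g p v u + b * g p w u"
  using metric_lincomb_right[OF assms] metric_symmetric assms tangent_space_lincomb by metis

text \<open>The definition of the metric only provides \<open>DIM('e)\<close> orthonormal vectors.
  That they span is obtained in one chart \<open>c\<close>: \<open>V\<close>, which builds a vector
  from its coefficients, followed by the component in \<open>c\<close>, is a linear injection of
  \<open>'e\<close> into itself, hence surjective. \<open>coord\<close> then picks the coefficients
  of a vector.\<close>

lemma minkowski_coordinates:
  obtains e :: 'e and coord where "e \<in> Basis"
    and "\<And>u w. u \<in> tangent_space A p \<Longrightarrow> w \<in> tangent_space A p \<Longrightarrow>
      g p u w = minkowski e (coord u) (coord w)"
proof -
  have "\<exists>E. \<exists>e\<in>Basis. (\<forall>b\<in>Basis. E b \<in> tangent_space A p) \<and>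
      (\<forall>b\<in>Basis. \<forall>b'\<in>Basis. g p (E b) (E b') = (if b \<noteq> b' then 0 else if (b::'e) = e then -1 else 1))"
    using spacetime unfolding spacetime_def lorentzian_metric_def by blast
  then obtain E and e :: 'e where e: "e \<in> Basis" and E: "\<And>b. b \<in> Basis \<Longrightarrow> E b \<in> tangent_space A p"
    and orth: "\<And>b b'. b \<in> Basis \<Longrightarrow> b' \<in> Basis \<Longrightarrow>
      g p (E b) (E b') = (if b \<noteq> b' then 0 else if (b::'e) = e then -1 else 1)"
    by blast
  obtain c where c: "c \<in> A" "p \<in> cdom c" by (rule chart_at)
  define V where "V u = (\<lambda>d. \<Sum>b\<in>Basis. (u \<bullet> b) *\<^sub>R E b d)" for u :: 'e
  have V: "V u \<in> tangent_space A p" for u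
    using linear_form_on_sum[OF metric_linear_form[OF tzero_in_tangent_space, of p], of Basis E "\<lambda>b. u \<bullet> b"] E
    unfolding V_def by simp
  have gV: "g p w (V u) = (\<Sum>b\<in>Basis. (u \<bullet> b) * g p w (E b))" if "w \<in> tangent_space A p" for u w
    using linear_form_on_sum[OF metric_linear_form[OF that], of Basis E "\<lambda>b. u \<bullet> b"] E
    unfolding V_def by simp
  have gEV: "g p (E b) (V u) = (u \<bullet> b) * (if b = e then -1 else 1)" if b: "b \<in> Basis" for b u
  proof -
    have "g p (E b) (V u) = (\<Sum>b'\<in>Basis. if b = b' then (u \<bullet> b) * (if b = e then -1 else 1) else 0)"
      unfolding gV[OF E[OF b]] by (rule sum.cong) (auto simp: orth b)
    then show ?thesis using b by simp
  qed
  have gVV: "g p (V u) (V w) = minkowski e u w" for u w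
  proof -
    have "g p (V u) (E b) = (u \<bullet> b) * (if b = e then -1 else 1)" if "b \<in> Basis" for b
      using gEV[OF that] metric_symmetric[OF V E[OF that]] by simp
    then show ?thesis
      unfolding gV[OF V] minkowski_basis_representation[OF e] by (intro sum.cong) auto
  qed
  have lin: "linear (\<lambda>u. V u c)"
    unfolding V_def by (intro linearI)
      (simp_all add: inner_add_left scaleR_left_distrib sum.distrib scaleR_right.sum)
  \<comment> \<open>A vector with zero component in \<open>c\<close> is the zero vector, so all its
    products with the frame vanish; by orthonormality these products are, up to sign, its
    coefficients.\<close>
  have "inj (\<lambda>u. V u c)"
    unfolding linear_injective_0[OF lin]
  proof (intro allI impI)
    fix u assume "V u c = 0"
    moreover have "V 0 c = 0" by (simp add: V_def)
    ultimately have "V u = V 0" by (intro tangent_space_eqI[OF V V c]) simp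
    then have "(u \<bullet> b) * (if b = e then -1 else 1) = 0" if "b \<in> Basis" for b
      using gEV[OF that, of u] gEV[OF that, of 0] by simp
    then have "u \<bullet> b = 0" if "b \<in> Basis" for b
      using that by (cases "b = e") fastforce+
    then show "u = 0" using euclidean_eqI[of u 0] by simp
  qed
  then have surj: "surj (\<lambda>u. V u c)" using linear_injective_imp_surjective[OF lin] by blast
  have "\<exists>u. V u = w" if "w \<in> tangent_space A p" for w
  proof -
    obtain u where "V u c = w c" using surjD[OF surj, of "w c"] by metis
    then have "V u = w" by (rule tangent_space_eqI[OF V that c])
    then show ?thesis ..
  qed
  then obtain coord where coord: "\<And>w. w \<in> tangent_space A p \<Longrightarrow> V (coord w) = w" by metis
  show ?thesis
  proof (rule that[OF e])
    fix u w assume "u \<in> tangent_space A p" "w \<in> tangent_space A p"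
    then show "g p u w = minkowski e (coord u) (coord w)"
      using gVV[of "coord u" "coord w"] coord by simp
  qed
qed

lemma reverse_Cauchy_Schwarz:
  assumes "u \<in> tangent_space A p" "w \<in> tangent_space A p" "g p u u < 0"
  shows "g p u u * g p w w \<le> (g p u w)\<^sup>2"
proof -
  obtain e :: 'e and coord where e: "e \<in> Basis"
    and *: "\<And>u w. u \<in> tangent_space A p \<Longrightarrow> w \<in> tangent_space A p \<Longrightarrow>
      g p u w = minkowski e (coord u) (coord w)"
    using minkowski_coordinates[of p] by blast
  show ?thesis
    using minkowski_reverse_Cauchy_Schwarz[OF norm_Basis[OF e], of "coord u" "coord w"] assms by (simp add: *)
qed

lemma time_cone_transitive:
  assumes "u \<in> tangent_space A p" "v \<in> tangent_space A p" "w \<in> tangent_space A p"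
    and "g p u u < 0" "g p v v < 0" "g p w w < 0" "g p u v < 0" "g p v w < 0"
  shows "g p u w < 0"
proof -
  obtain e :: 'e and coord where e: "e \<in> Basis"
    and *: "\<And>u w. u \<in> tangent_space A p \<Longrightarrow> w \<in> tangent_space A p \<Longrightarrow>
      g p u w = minkowski e (coord u) (coord w)"
    using minkowski_coordinates[of p] by blast
  show ?thesis
    using minkowski_time_cone[OF norm_Basis[OF e], of "coord u" "coord v" "coord w"] assms by (simp add: *)
qed

lemma T_in_tangent_space: "T p \<in> tangent_space A p"
  using spacetime unfolding spacetime_def vector_field_def by blast

lemma T_timelike: "g p (T p) (T p) < 0"
  using spacetime unfolding spacetime_def by blast

text \<open>The last hypothesis is \<open>F\<^sup>+(w) < \<beta>\<close> for the function \<open>F\<^sup>+\<close> of the observer field \<open>x\<close>.\<close>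

lemma future_timelike_lincomb:
  assumes x: "future_timelike A g T p x" and w: "w \<in> tangent_space A p"
    and \<beta>: "\<beta> > 0" "g p x x = - \<beta>\<^sup>2"
    and F: "g p x w / \<beta> + sqrt ((g p x w)\<^sup>2 / \<beta>\<^sup>2 + g p w w) < \<beta>"
  shows "future_timelike A g T p (lincomb 1 x 1 w)"
proof -
  let ?v = "lincomb 1 x 1 w" and ?o = "g p x w"
  have xT: "x \<in> tangent_space A p" "g p x x < 0" "g p x (T p) < 0"
    using x unfolding future_timelike_def by auto
  have v: "?v \<in> tangent_space A p" using tangent_space_lincomb xT(1) w .
  \<comment> \<open>Reverse Cauchy-Schwarz makes the radicand nonnegative, so that squaring the
    square root returns it.\<close>
  have "- \<beta>\<^sup>2 * g p w w \<le> ?o\<^sup>2" using reverse_Cauchy_Schwarz[OF xT(1) w xT(2)] \<beta>(2) by simp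
  then have "0 \<le> (?o\<^sup>2 + \<beta>\<^sup>2 * g p w w) / \<beta>\<^sup>2" by simp
  also have eq: "(?o\<^sup>2 + \<beta>\<^sup>2 * g p w w) / \<beta>\<^sup>2 = ?o\<^sup>2 / \<beta>\<^sup>2 + g p w w"
    using \<beta>(1) by (simp add: field_simps)
  finally have nonneg: "0 \<le> ?o\<^sup>2 / \<beta>\<^sup>2 + g p w w" .
  have less: "sqrt (?o\<^sup>2 / \<beta>\<^sup>2 + g p w w) < \<beta> - ?o / \<beta>" using F by simp
  \<comment> \<open>Dropping the nonnegative root leaves the cone condition
    \<open>g p ?v x < 0\<close>. Squaring the full inequality gives \<open>g p ?v ?v < 0\<close>,
    the terms \<open>?o\<^sup>2 / \<beta>\<^sup>2\<close> cancelling.\<close>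
  then have "?o / \<beta> < \<beta>" using real_sqrt_ge_zero[OF nonneg] by linarith
  then have o: "?o < \<beta>\<^sup>2" using \<beta>(1) by (simp add: field_simps power2_eq_square)
  have "(sqrt (?o\<^sup>2 / \<beta>\<^sup>2 + g p w w))\<^sup>2 < (\<beta> - ?o / \<beta>)\<^sup>2"
    using less real_sqrt_ge_zero[OF nonneg] by (intro power_strict_mono) auto
  then have "?o\<^sup>2 / \<beta>\<^sup>2 + g p w w < \<beta>\<^sup>2 - 2 * ?o + ?o\<^sup>2 / \<beta>\<^sup>2"
    using nonneg \<beta>(1) by (simp add: power2_diff power_divide)
  moreover have "g p ?v ?v = - \<beta>\<^sup>2 + 2 * ?o + g p w w"
    using metric_lincomb_left[OF v xT(1) w, of 1 1] metric_lincomb_right[OF xT(1) xT(1) w, of 1 1]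
      metric_lincomb_right[OF w xT(1) w, of 1 1] metric_symmetric[OF xT(1) w] \<beta>(2) by simp
  ultimately have vv: "g p ?v ?v < 0" by linarith
  have "g p ?v x < 0"
    using metric_lincomb_left[OF xT(1) xT(1) w, of 1 1] metric_symmetric[OF xT(1) w] \<beta>(2) o by simp
  \<comment> \<open>The estimate compares \<open>?v\<close> with the observer \<open>x\<close> only;
    \<open>x\<close> links it to the time orientation \<open>T\<close>.\<close>
  then have "g p ?v (T p) < 0"
    using time_cone_transitive[OF v xT(1) T_in_tangent_space vv xT(2) T_timelike _ xT(3)] by blast
  then show ?thesis using v vv unfolding future_timelike_def by blast
qed

end

section \<open>Flow lines\<close>

locale spacetime_flow = lorentzian_spacetime A g T
  for A :: "('m::{t2_space,second_countable_topology}, 'e::euclidean_space) chart set"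
    and g :: "'m \<Rightarrow> ('m, 'e) tvec \<Rightarrow> ('m, 'e) tvec \<Rightarrow> real"
    and T :: "'m \<Rightarrow> ('m, 'e) tvec" +
  fixes X :: "'m \<Rightarrow> ('m, 'e) tvec"
    and \<phi> :: "real \<Rightarrow> 'm \<Rightarrow> 'm"
  assumes X_future: "\<And>p. future_timelike A g T p (X p)"
    and flow: "complete_with_flow A X \<phi>"
begin

lemma X_in_tangent_space: "X p \<in> tangent_space A p"
  using X_future unfolding future_timelike_def by blast

lemma X_timelike: "g p (X p) (X p) < 0"
  using X_future unfolding future_timelike_def by blast

lemma flow_zero: "\<phi> 0 p = p"
  using flow unfolding complete_with_flow_def by blast

lemma flow_add: "\<phi> (s + t) p = \<phi> s (\<phi> t p)"
  using flow unfolding complete_with_flow_def by blast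

lemma flow_minus: "\<phi> (- t) (\<phi> t p) = p"
  using flow_add[of "- t" t p] flow_zero by simp

lemma continuous_flow: "continuous_on UNIV (\<lambda>(t, p). \<phi> t p)"
  using flow unfolding complete_with_flow_def by blast

lemma continuous_on_flow:
  assumes "continuous_on S r" "continuous_on S \<sigma>"
  shows "continuous_on S (\<lambda>t. \<phi> (r t) (\<sigma> t))"
  using continuous_on_compose2[OF continuous_flow continuous_on_Pair[OF assms]] by simp

lemma isCont_flow:
  assumes "isCont r t" "isCont \<sigma> t"
  shows "isCont (\<lambda>t. \<phi> (r t) (\<sigma> t)) t"
proof -
  have "isCont (\<lambda>(t, p). \<phi> t p) (r t, \<sigma> t)"
    using continuous_flow by (simp add: continuous_on_eq_continuous_at)
  from isCont_o2[OF isCont_Pair[OF assms] this] show ?thesis by simp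
qed

lemma integral_curve_flow: "integral_curve A X UNIV (\<lambda>t. \<phi> t p)"
  using flow unfolding complete_with_flow_def by blast

abbreviation flow_chart :: "('m, 'e) chart \<Rightarrow> ('m, 'e) chart \<Rightarrow> real \<times> 'e \<Rightarrow> 'e" where
  "flow_chart c d \<equiv> \<lambda>(t, y). cmap d (\<phi> t (cinv c y))"

lemma smooth_flow_chart:
  assumes "c \<in> A" "d \<in> A"
  shows "smooth_on {(t, y). y \<in> cran c \<and> \<phi> t (cinv c y) \<in> cdom d} (flow_chart c d)"
  using flow assms unfolding complete_with_flow_def by blast

lemma flow_chart_has_derivative:
  assumes "c \<in> A" "d \<in> A" "x \<in> cdom c" "\<phi> t x \<in> cdom d"
  shows "(flow_chart c d has_derivative frechet_derivative (flow_chart c d) (at (t, cmap c x)))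
    (at (t, cmap c x))"
  by (rule smooth_on_has_derivative[OF smooth_flow_chart[OF assms(1,2)]])
    (use assms in \<open>auto simp: cinv_cmap\<close>)

lemma flow_chart_linear:
  assumes "c \<in> A" "d \<in> A" "x \<in> cdom c" "\<phi> t x \<in> cdom d"
  shows "linear (frechet_derivative (flow_chart c d) (at (t, cmap c x)))"
  using flow_chart_has_derivative[OF assms] by (rule has_derivative_linear)

lemma flow_curve_has_vector_derivative:
  assumes "c \<in> A" "d \<in> A" "\<sigma> t \<in> cdom c" "\<phi> (r t) (\<sigma> t) \<in> cdom d" "isCont \<sigma> t"
    and \<sigma>': "((cmap c \<circ> \<sigma>) has_vector_derivative w) (at t)"
    and r': "(r has_vector_derivative k) (at t)"
  shows "((cmap d \<circ> (\<lambda>s. \<phi> (r s) (\<sigma> s))) has_vector_derivative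
    frechet_derivative (flow_chart c d) (at (r t, cmap c (\<sigma> t))) (k, w)) (at t)"
proof -
  let ?D = "frechet_derivative (flow_chart c d) (at (r t, cmap c (\<sigma> t)))"
  have "\<forall>\<^sub>F s in at t. \<sigma> s \<in> cdom c"
    using assms(1,3,5) open_cdom unfolding isCont_def tendsto_def by blast
  then have ev: "\<forall>\<^sub>F s in at t. flow_chart c d (r s, (cmap c \<circ> \<sigma>) s) = (cmap d \<circ> (\<lambda>s. \<phi> (r s) (\<sigma> s))) s"
    by eventually_elim (simp add: cinv_cmap assms)
  have "(flow_chart c d has_derivative ?D) (at (r t, (cmap c \<circ> \<sigma>) t))"
    using flow_chart_has_derivative[OF assms(1-4)] by simp
  from has_derivative_compose[OF has_derivative_Pair[OF r'[unfolded has_vector_derivative_def]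
        \<sigma>'[unfolded has_vector_derivative_def]] this]
  have "((\<lambda>s. flow_chart c d (r s, (cmap c \<circ> \<sigma>) s)) has_derivative (\<lambda>h. ?D (h *\<^sub>R k, h *\<^sub>R w))) (at t)" .
  moreover have "?D (h *\<^sub>R k, h *\<^sub>R w) = h *\<^sub>R ?D (k, w)" for h
    using linear_scale[OF flow_chart_linear[OF assms(1-4)], of h "(k, w)"] by simp
  ultimately have "((\<lambda>s. flow_chart c d (r s, (cmap c \<circ> \<sigma>) s)) has_derivative (\<lambda>h. h *\<^sub>R ?D (k, w))) (at t)"
    by simp
  then show ?thesis
    unfolding has_vector_derivative_def
    by (rule has_derivative_transform_eventually[OF _ ev]) (simp_all add: cinv_cmap assms(1,3))
qed

lemma flow_has_vector_derivative:
  assumes "d \<in> A" "\<phi> t x \<in> cdom d"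
  shows "((cmap d \<circ> (\<lambda>s. \<phi> s x)) has_vector_derivative X (\<phi> t x) d) (at t)"
  using integral_curve_flow assms unfolding integral_curve_def by blast

lemma flow_chart_derivative_time:
  assumes "c \<in> A" "d \<in> A" "x \<in> cdom c" "\<phi> t x \<in> cdom d"
  shows "frechet_derivative (flow_chart c d) (at (t, cmap c x)) (1, 0) = X (\<phi> t x) d"
proof -
  have 1: "((cmap c \<circ> (\<lambda>s::real. x)) has_vector_derivative 0) (at t)" by (simp add: o_def)
  have "((cmap d \<circ> (\<lambda>s. \<phi> s x)) has_vector_derivative
      frechet_derivative (flow_chart c d) (at (t, cmap c x)) (1, 0)) (at t)"
    using flow_curve_has_vector_derivative[OF assms(1,2) _ _ _ 1 has_vector_derivative_id] assms by simp
  then show ?thesis using flow_has_vector_derivative[OF assms(2,4)] by (rule vector_derivative_unique_at)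
qed

text \<open>The curve \<open>t \<mapsto> \<phi> (- t) (\<gamma> t)\<close> has zero velocity; this replaces the uniqueness theorem for
  ordinary differential equations.\<close>

lemma integral_curve_flow_back:
  assumes \<gamma>: "integral_curve A X J \<gamma>" and t: "t \<in> J" and d: "d \<in> A" "\<phi> (- t) (\<gamma> t) \<in> cdom d"
  shows "((cmap d \<circ> (\<lambda>s. \<phi> (- s) (\<gamma> s))) has_vector_derivative 0) (at t)"
proof -
  obtain c where c: "c \<in> A" "\<gamma> t \<in> cdom c" by (rule chart_at)
  let ?D = "frechet_derivative (flow_chart c d) (at (- t, cmap c (\<gamma> t)))"
  have minus: "(uminus has_vector_derivative - 1) (at t)"
    using has_vector_derivative_minus[OF has_vector_derivative_id] by simp
  have cont: "isCont \<gamma> t" and \<gamma>': "((cmap c \<circ> \<gamma>) has_vector_derivative X (\<gamma> t) c) (at t)"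
    using \<gamma> t c unfolding integral_curve_def by (auto simp: continuous_on_eq_continuous_at)
  have 1: "((cmap d \<circ> (\<lambda>s. \<phi> (- s) (\<gamma> s))) has_vector_derivative ?D (- 1, X (\<gamma> t) c)) (at t)"
    using flow_curve_has_vector_derivative[OF c(1) d(1) c(2) _ cont \<gamma>' minus] d by simp
  \<comment> \<open>\<open>?\<eta>\<close> is the flow line through \<open>\<gamma> t\<close>, with
    the same velocity there as \<open>\<gamma>\<close>. By the chain rule both curves, flowed back
    by \<open>- s\<close>, have the same derivative at \<open>t\<close>; for \<open>?\<eta>\<close>
    the result is a constant curve, so that derivative is \<open>0\<close>.\<close>
  let ?\<eta> = "\<lambda>s. \<phi> (s - t) (\<gamma> t)"
  have \<eta>: "?\<eta> t = \<gamma> t" by (simp add: flow_zero)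
  have "isCont ?\<eta> t" by (intro isCont_flow continuous_intros)
  moreover have "((cmap c \<circ> ?\<eta>) has_vector_derivative X (\<gamma> t) c) (at t)"
  proof -
    have "((cmap c \<circ> (\<lambda>s. \<phi> s (\<gamma> t))) has_vector_derivative X (\<gamma> t) c) (at (t - t))"
      using flow_has_vector_derivative[OF c(1), of "t - t" "\<gamma> t"] c(2) by (simp add: flow_zero)
    moreover have "((\<lambda>s. s - t) has_vector_derivative 1) (at t)"
      by (auto simp: has_vector_derivative_def intro!: derivative_eq_intros)
    ultimately show ?thesis
      using vector_diff_chain_at[of "\<lambda>s. s - t" 1 t "cmap c \<circ> (\<lambda>s. \<phi> s (\<gamma> t))" "X (\<gamma> t) c"]
      by (simp add: o_def)
  qed
  ultimately have "((cmap d \<circ> (\<lambda>s. \<phi> (- s) (?\<eta> s))) has_vector_derivative ?D (- 1, X (\<gamma> t) c)) (at t)"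
    using flow_curve_has_vector_derivative[OF c(1) d(1), of ?\<eta> t uminus, OF _ _ _ _ minus] c(2) d(2)
    by (simp add: flow_zero)
  moreover have "(\<lambda>s. \<phi> (- s) (?\<eta> s)) = (\<lambda>s. \<phi> (- t) (\<gamma> t))"
    using flow_add[of "- s" "s - t" "\<gamma> t" for s] by (simp add: fun_eq_iff)
  ultimately have "((\<lambda>s::real. cmap d (\<phi> (- t) (\<gamma> t))) has_vector_derivative ?D (- 1, X (\<gamma> t) c)) (at t)"
    by (simp add: o_def)
  then have "?D (- 1, X (\<gamma> t) c) = 0"
    using vector_derivative_unique_at has_vector_derivative_const by blast
  then show ?thesis using 1 by simp
qed

text \<open>Flowed back, the curve has zero derivative in every chart, so it is locally constant,
  hence constant on the interval \<open>J\<close>; \<open>q\<close> is its value.\<close>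

lemma integral_curve_eq_flow:
  assumes \<gamma>: "integral_curve A X J \<gamma>"
  obtains q where "\<And>t. t \<in> J \<Longrightarrow> \<gamma> t = \<phi> t q"
proof -
  let ?\<delta> = "\<lambda>s. \<phi> (- s) (\<gamma> s)"
  have J: "open J" "connected J" "J \<noteq> {}" "continuous_on J \<gamma>"
    using \<gamma> unfolding integral_curve_def by (auto simp: is_interval_connected_1)
  have cont: "continuous_on J ?\<delta>" by (intro continuous_on_flow continuous_intros J)
  have loc: "\<forall>\<^sub>F s in at t within J. ?\<delta> t = ?\<delta> s" if t: "t \<in> J" for t
  proof -
    obtain d where d: "d \<in> A" "?\<delta> t \<in> cdom d" by (rule chart_at)
    have "open (J \<inter> ?\<delta> -` cdom d)"
      by (rule continuous_open_preimage[OF cont J(1) open_cdom[OF d(1)]])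
    then obtain e where e: "e > 0" "ball t e \<subseteq> J \<inter> ?\<delta> -` cdom d"
      using t d unfolding open_contains_ball by blast
    have "\<exists>k. \<forall>s\<in>ball t e. (cmap d \<circ> ?\<delta>) s = k"
    proof (rule has_vector_derivative_zero_constant)
      fix s assume "s \<in> ball t e"
      then show "((cmap d \<circ> ?\<delta>) has_vector_derivative 0) (at s within ball t e)"
        using integral_curve_flow_back[OF \<gamma>, of s d] d e has_vector_derivative_at_within by blast
    qed auto
    then have eq: "cmap d (?\<delta> t) = cmap d (?\<delta> s)" if "s \<in> ball t e" for s
      using that e(1) by force
    have "?\<delta> t = ?\<delta> s" if s: "s \<in> ball t e" for s
    proof -
      have "?\<delta> s \<in> cdom d" using s e(2) by blast
      then show ?thesis
        using arg_cong[OF eq[OF s], of "cinv d"] cinv_cmap[OF d] cinv_cmap[OF d(1), of "?\<delta> s"] by metis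
    qed
    then show ?thesis
      unfolding eventually_at using e(1) by (metis dist_commute mem_ball)
  qed
  obtain t0 where t0: "t0 \<in> J" using J(3) by blast
  have "?\<delta> t0 = ?\<delta> t" if "t \<in> J" for t
    using connected_local_const[OF J(2) t0 that, where f = "?\<delta>", OF ballI[OF loc]] .
  then have "\<gamma> t = \<phi> t (?\<delta> t0)" if "t \<in> J" for t
    using flow_minus[of "- t" "\<gamma> t"] that by simp
  then show ?thesis by (rule that)
qed

section \<open>Maximal integral curves and leaves as orbits of the flow\<close>

lemma maximal_integral_curve_flow: "maximal_integral_curve A X UNIV (\<lambda>t. \<phi> t p)"
  unfolding maximal_integral_curve_def using integral_curve_flow by blast

lemma maximal_integral_curve_eq_flow:
  assumes "maximal_integral_curve A X J \<gamma>"
  obtains q where "J = UNIV" and "\<gamma> = (\<lambda>t. \<phi> t q)"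
proof -
  obtain q where q: "\<And>t. t \<in> J \<Longrightarrow> \<gamma> t = \<phi> t q"
    using assms integral_curve_eq_flow unfolding maximal_integral_curve_def by blast
  have "J = UNIV"
    using assms integral_curve_flow[of q] q unfolding maximal_integral_curve_def by (metis subset_UNIV)
  with q that show ?thesis by blast
qed

lemma integral_foliation_eq_flow:
  assumes "L \<in> integral_foliation A X"
  obtains q where "L = range (\<lambda>t. \<phi> t q)"
  using assms that unfolding integral_foliation_def by (auto elim!: maximal_integral_curve_eq_flow)

end

section \<open>The differential of the flow\<close>

context smooth_manifold
begin

text \<open>A straight line in the chart does it. Realising vectors as velocities turns statements
  about the differential of the flow into statements about curves.\<close>

lemma tangent_vector_curve:
  assumes v: "v \<in> tangent_space A x" and c: "c \<in> A" "x \<in> cdom c"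
  obtains \<sigma> where "isCont \<sigma> (0::real)" "\<sigma> 0 = x" "((cmap c \<circ> \<sigma>) has_vector_derivative v c) (at 0)"
    "velocity A \<sigma> 0 = v"
proof -
  let ?l = "\<lambda>s::real. cmap c x + s *\<^sub>R v c"
  let ?\<sigma> = "\<lambda>s. cinv c (?l s)"
  have cont: "isCont ?l s" for s by (intro continuous_intros)
  have "isCont (cinv c) (?l 0)"
    using continuous_on_cinv[OF c(1)] open_cran[OF c(1)] c(2) by (auto simp: continuous_on_eq_continuous_at)
  with cont have \<sigma>: "isCont ?\<sigma> 0" by (rule isCont_o2)
  have \<sigma>0: "?\<sigma> 0 = x" by (simp add: cinv_cmap c)
  have "\<forall>\<^sub>F s in at 0. ?l s \<in> cran c"
    using cont[of 0] open_cran[OF c(1)] c(2) unfolding isCont_def tendsto_def by auto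
  then have ev: "\<forall>\<^sub>F s in at 0. ?l s = (cmap c \<circ> ?\<sigma>) s"
    by eventually_elim (use cmap_cinv[OF c(1)] in simp)
  have "(?l has_derivative (\<lambda>h. h *\<^sub>R v c)) (at 0)" by (auto intro!: derivative_eq_intros)
  then have \<sigma>': "((cmap c \<circ> ?\<sigma>) has_vector_derivative v c) (at 0)"
    unfolding has_vector_derivative_def
    by (rule has_derivative_transform_eventually[OF _ ev]) (simp_all add: cinv_cmap c)
  have "velocity A ?\<sigma> 0 = v"
  proof (rule tangent_space_eqI)
    show "velocity A ?\<sigma> 0 \<in> tangent_space A x"
      using velocity_in_tangent_space[OF \<sigma> c(1) _ \<sigma>'] unfolding \<sigma>0 using c(2) by blast
    show "velocity A ?\<sigma> 0 c = v c"
      using velocity_chart[OF c(1) _ \<sigma>'] unfolding \<sigma>0 using c(2) by blast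
  qed (use v c in auto)
  with that[OF \<sigma> \<sigma>0 \<sigma>'] show ?thesis .
qed

end

context spacetime_flow
begin

text \<open>This is literally the choice made inside \<open>flow_differential\<close>; naming it
  allows the chosen chart to be treated as an ordinary chart around \<open>x\<close>.\<close>

definition base_chart :: "'m \<Rightarrow> ('m, 'e) chart" where
  "base_chart x = (SOME c. c \<in> A \<and> x \<in> cdom c)"

lemma base_chart: "base_chart x \<in> A" "x \<in> cdom (base_chart x)"
proof -
  have "\<exists>c. c \<in> A \<and> x \<in> cdom c" using chart_at[of x] by metis
  from someI_ex[OF this] show "base_chart x \<in> A" "x \<in> cdom (base_chart x)"
    unfolding base_chart_def by blast+
qed

lemma flow_differential_base_chart:
  "flow_differential A \<phi> \<tau> x (k, v) d = (if d \<in> A \<and> \<phi> \<tau> x \<in> cdom d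
     then frechet_derivative (flow_chart (base_chart x) d) (at (\<tau>, cmap (base_chart x) x)) (k, v (base_chart x))
     else 0)"
  unfolding flow_differential_def base_chart_def Let_def by simp

lemma flow_differential_time: "flow_differential A \<phi> \<tau> x (1, tzero) = X (\<phi> \<tau> x)"
proof
  fix d show "flow_differential A \<phi> \<tau> x (1, tzero) d = X (\<phi> \<tau> x) d"
    unfolding flow_differential_base_chart tzero_def
    using flow_chart_derivative_time[OF base_chart(1) _ base_chart(2), of d \<tau> x]
      tangent_space_outside[OF X_in_tangent_space, of d] by auto
qed

lemma flow_differential_lincomb:
  "flow_differential A \<phi> \<tau> x (a * k + b * l, lincomb a v b w) =
    lincomb a (flow_differential A \<phi> \<tau> x (k, v)) b (flow_differential A \<phi> \<tau> x (l, w))"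
proof
  fix d
  show "flow_differential A \<phi> \<tau> x (a * k + b * l, lincomb a v b w) d =
    lincomb a (flow_differential A \<phi> \<tau> x (k, v)) b (flow_differential A \<phi> \<tau> x (l, w)) d"
  proof (cases "d \<in> A \<and> \<phi> \<tau> x \<in> cdom d")
    case True
    let ?c = "base_chart x"
    let ?D = "frechet_derivative (flow_chart ?c d) (at (\<tau>, cmap ?c x))"
    have lin: "linear ?D" using flow_chart_linear[OF base_chart(1) _ base_chart(2)] True by blast
    have "(a * k + b * l, lincomb a v b w ?c) = a *\<^sub>R (k, v ?c) + b *\<^sub>R (l, w ?c)"
      by (simp add: lincomb_def)
    then have "?D (a * k + b * l, lincomb a v b w ?c) = a *\<^sub>R ?D (k, v ?c) + b *\<^sub>R ?D (l, w ?c)"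
      by (simp only: linear_add[OF lin] linear_scale[OF lin])
    then show ?thesis
      unfolding lincomb_def[of _ "flow_differential A \<phi> \<tau> x (k, v)"] flow_differential_base_chart
      by (simp only: if_P[OF True])
  next
    case False
    show ?thesis
      unfolding lincomb_def[of _ "flow_differential A \<phi> \<tau> x (k, v)"] flow_differential_base_chart
      by (simp only: if_not_P[OF False] scaleR_zero_right add_0)
  qed
qed

text \<open>The differential is computed in the chosen base chart, while \<open>c\<close> may be any
  chart in which \<open>\<sigma>\<close> is known to be differentiable; changing charts along the
  curve bridges the two.\<close>

lemma velocity_flow:
  assumes \<sigma>: "isCont \<sigma> t" and c: "c \<in> A" "\<sigma> t \<in> cdom c"
    and \<sigma>': "((cmap c \<circ> \<sigma>) has_vector_derivative w) (at t)"
    and r': "(r has_vector_derivative k) (at t)"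
  shows "velocity A (\<lambda>s. \<phi> (r s) (\<sigma> s)) t = flow_differential A \<phi> (r t) (\<sigma> t) (k, velocity A \<sigma> t)"
    and "velocity A (\<lambda>s. \<phi> (r s) (\<sigma> s)) t \<in> tangent_space A (\<phi> (r t) (\<sigma> t))"
proof -
  let ?b = "base_chart (\<sigma> t)"
  obtain w' where w': "((cmap ?b \<circ> \<sigma>) has_vector_derivative w') (at t)"
    using curve_change_chart[OF \<sigma> c(1) base_chart(1) c(2) base_chart(2) \<sigma>'] by blast
  have b: "velocity A \<sigma> t ?b = w'" using velocity_chart[OF base_chart(1) base_chart(2) w'] .
  show "velocity A (\<lambda>s. \<phi> (r s) (\<sigma> s)) t = flow_differential A \<phi> (r t) (\<sigma> t) (k, velocity A \<sigma> t)"
  proof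
    fix d
    show "velocity A (\<lambda>s. \<phi> (r s) (\<sigma> s)) t d = flow_differential A \<phi> (r t) (\<sigma> t) (k, velocity A \<sigma> t) d"
      unfolding flow_differential_base_chart b velocity_def[of A "\<lambda>s. \<phi> (r s) (\<sigma> s)"]
      using vector_derivative_at[OF flow_curve_has_vector_derivative[OF base_chart(1) _ base_chart(2) _ \<sigma> w' r', of d]]
      by simp
  qed
  obtain d where d: "d \<in> A" "\<phi> (r t) (\<sigma> t) \<in> cdom d" by (rule chart_at)
  have "isCont r t" using r' by (rule has_vector_derivative_continuous)
  then have "isCont (\<lambda>s. \<phi> (r s) (\<sigma> s)) t" using isCont_flow \<sigma> by blast
  from velocity_in_tangent_space[OF this d
      flow_curve_has_vector_derivative[OF base_chart(1) d(1) base_chart(2) d(2) \<sigma> w' r']]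
  show "velocity A (\<lambda>s. \<phi> (r s) (\<sigma> s)) t \<in> tangent_space A (\<phi> (r t) (\<sigma> t))" .
qed

text \<open>Compatibility of the components in different charts need not be checked by hand: the
  vector is the velocity at \<open>0\<close> of \<open>\<phi> (\<tau> + s * k) (\<sigma> s)\<close>,
  where \<open>\<sigma>\<close> has velocity \<open>v\<close>.\<close>

lemma flow_differential_in_tangent_space:
  assumes v: "v \<in> tangent_space A x"
  shows "flow_differential A \<phi> \<tau> x (k, v) \<in> tangent_space A (\<phi> \<tau> x)"
proof -
  obtain c where c: "c \<in> A" "x \<in> cdom c" by (rule chart_at)
  obtain \<sigma> where \<sigma>: "isCont \<sigma> (0::real)" "\<sigma> 0 = x" "((cmap c \<circ> \<sigma>) has_vector_derivative v c) (at 0)"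
    "velocity A \<sigma> 0 = v"
    using tangent_vector_curve[OF v c] by blast
  have r: "((\<lambda>s. \<tau> + s * k) has_vector_derivative k) (at 0)"
    by (auto simp: has_vector_derivative_def intro!: derivative_eq_intros)
  have "\<sigma> 0 \<in> cdom c" using \<sigma>(2) c(2) by simp
  from velocity_flow[OF \<sigma>(1) c(1) this \<sigma>(3) r] show ?thesis
    using \<sigma>(2,4) by simp
qed

text \<open>The term \<open>lincomb s v 0 v\<close> stands for the multiple of \<open>v\<close> by
  \<open>s\<close>. Since \<open>s * s = 1\<close>, the sign in front of the shift form and the sign
  of the vector cancel, and the quadratic part ignores the sign. Hence for both values of
  \<open>s\<close> the hypothesis is the bound \<open>F\<^sup>+(v) < \<beta>\<close> for the
  pushed-forward vector.\<close>

lemma future_timelike_flow_differential: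
  assumes v: "v \<in> tangent_space A x" and s: "s = 1 \<or> s = -1"
    and F: "F_flow s A g \<phi> \<tau> x (lincomb s v 0 v) < lapse A g \<phi> \<tau> x"
  shows "future_timelike A g T (\<phi> \<tau> x) (flow_differential A \<phi> \<tau> x (1, v))"
proof -
  let ?p = "\<phi> \<tau> x" and ?w = "flow_differential A \<phi> \<tau> x (0, v)" and ?\<beta> = "lapse A g \<phi> \<tau> x"
  have w: "?w \<in> tangent_space A ?p" using flow_differential_in_tangent_space[OF v] .
  have \<beta>2: "- g ?p (X ?p) (X ?p) > 0" using X_timelike by simp
  have \<beta>: "?\<beta> > 0" "g ?p (X ?p) (X ?p) = - ?\<beta>\<^sup>2"
    using \<beta>2 unfolding lapse_def flow_pullback_def flow_differential_time by simp_all
  have sv: "flow_differential A \<phi> \<tau> x (0, lincomb s v 0 v) = lincomb s ?w 0 ?w"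
    using flow_differential_lincomb[of \<tau> x s 0 0 0 v v] by simp
  have shift: "shift_form A g \<phi> \<tau> x (lincomb s v 0 v) = s * g ?p (X ?p) ?w"
    unfolding shift_form_def flow_pullback_def flow_differential_time sv
    using metric_lincomb_right[OF X_in_tangent_space w w] by simp
  have ss: "s * (s * a) = a" for a :: real using s by auto
  have form: "slice_form A g \<phi> \<tau> x (lincomb s v 0 v) (lincomb s v 0 v) = g ?p ?w ?w"
    unfolding slice_form_def flow_pullback_def sv
    using metric_lincomb_right[OF tangent_space_lincomb[OF w w] w w, of s 0 s 0]
      metric_lincomb_left[OF w w w, of s 0] ss by simp
  have s2: "(s * a)\<^sup>2 = a\<^sup>2" "s * (s * a / b) = a / b" for a b :: real using s by auto
  have "g ?p (X ?p) ?w / ?\<beta> + sqrt ((g ?p (X ?p) ?w)\<^sup>2 / ?\<beta>\<^sup>2 + g ?p ?w ?w) < ?\<beta>"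
    using F unfolding F_flow_def shift form s2 .
  from future_timelike_lincomb[OF X_future w \<beta> this]
  have "future_timelike A g T ?p (lincomb 1 (X ?p) 1 ?w)" .
  moreover have "flow_differential A \<phi> \<tau> x (1, v) = lincomb 1 (X ?p) 1 ?w"
    using flow_differential_lincomb[of \<tau> x 1 1 1 0 tzero v]
    by (simp add: flow_differential_time) (simp add: lincomb_def tzero_def)
  ultimately show ?thesis by simp
qed

end

section \<open>Slices\<close>

text \<open>Homogeneity holds for nonnegative factors only: the linear part changes sign with
  \<open>v\<close>, the square root does not.\<close>

lemma F_ref_scale:
  assumes "one_form_sub A \<Sigma> \<omega>\<^sub>0" "riemannian_metric_sub A \<Sigma> g\<^sub>0" "x \<in> \<Sigma>"
    and v: "v \<in> tangent_space_sub A \<Sigma> x" "lincomb k v 0 v \<in> tangent_space_sub A \<Sigma> x" and k: "k \<ge> 0"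
  shows "F_ref s \<omega>\<^sub>0 g\<^sub>0 x (lincomb k v 0 v) = k * F_ref s \<omega>\<^sub>0 g\<^sub>0 x v"
proof -
  let ?v = "lincomb k v 0 v"
  have "linear_form_on (tangent_space_sub A \<Sigma> x) (\<omega>\<^sub>0 x)"
    using assms(1,3) unfolding one_form_sub_def by blast
  then have \<omega>: "\<omega>\<^sub>0 x ?v = k * \<omega>\<^sub>0 x v"
    using v(1) unfolding linear_form_on_def by simp
  have B: "symmetric_bilinear_on (tangent_space_sub A \<Sigma> x) (g\<^sub>0 x)"
    using assms(2,3) unfolding riemannian_metric_sub_def by blast
  then have lin: "linear_form_on (tangent_space_sub A \<Sigma> x) (g\<^sub>0 x u)" if "u \<in> tangent_space_sub A \<Sigma> x" for u
    using that unfolding symmetric_bilinear_on_def by blast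
  have "g\<^sub>0 x ?v ?v = k * g\<^sub>0 x ?v v"
    using lin[OF v(2)] v(1) unfolding linear_form_on_def by simp
  also have "g\<^sub>0 x ?v v = g\<^sub>0 x v ?v"
    using B v unfolding symmetric_bilinear_on_def by blast
  also have "\<dots> = k * g\<^sub>0 x v v"
    using lin[OF v(1)] v(1) unfolding linear_form_on_def by simp
  finally have eq: "(\<omega>\<^sub>0 x ?v)\<^sup>2 + g\<^sub>0 x ?v ?v = k\<^sup>2 * ((\<omega>\<^sub>0 x v)\<^sup>2 + g\<^sub>0 x v v)"
    unfolding \<omega> by (simp add: power2_eq_square algebra_simps)
  then show ?thesis
    unfolding F_ref_def eq real_sqrt_mult using k \<omega> by (simp add: distrib_left)
qed

locale sliced_flow = spacetime_flow A g T X \<phi>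
  for A :: "('m::{t2_space,second_countable_topology}, real \<times> 's::euclidean_space) chart set"
    and g :: "'m \<Rightarrow> ('m, real \<times> 's) tvec \<Rightarrow> ('m, real \<times> 's) tvec \<Rightarrow> real"
    and T :: "'m \<Rightarrow> ('m, real \<times> 's) tvec"
    and X :: "'m \<Rightarrow> ('m, real \<times> 's) tvec"
    and \<phi> :: "real \<Rightarrow> 'm \<Rightarrow> 'm" +
  fixes \<Sigma> :: "'m set"
  assumes slice: "slice A X \<Sigma>"
begin

lemma slice_crossing: "\<exists>!t. \<phi> t p \<in> \<Sigma>"
  using slice maximal_integral_curve_flow[of p] unfolding slice_def by force

lemma flow_to_slice:
  obtains t x where "x \<in> \<Sigma>" "p = \<phi> t x"
proof -
  obtain s where "\<phi> s p \<in> \<Sigma>" using slice_crossing[of p] by blast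
  then show ?thesis using that[of "\<phi> s p" "- s"] flow_minus by simp
qed

lemma flow_slice_injective:
  assumes "x \<in> \<Sigma>" "y \<in> \<Sigma>" "\<phi> s x = \<phi> t y"
  shows "s = t" and "x = y"
proof -
  have eq: "\<phi> (s - t) x = y"
    using assms(3) flow_add[of "- t" s x] flow_minus[of t y] by simp
  have "s - t = 0"
    using slice_crossing[of x] assms(1,2) eq flow_zero[of x] by metis
  then show "s = t" "x = y" using eq flow_zero by auto
qed

section \<open>Slice charts and tangent vectors of the slice\<close>

lemma slice_chartD:
  assumes "slice_chart A \<Sigma> c"
  shows "c \<in> A"
    and "x \<in> cdom c \<Longrightarrow> x \<in> \<Sigma> \<Longrightarrow> cmap c x = (0, snd (cmap c x))"
    and "(0, y) \<in> cran c \<Longrightarrow> cinv c (0, y) \<in> \<Sigma>"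
proof -
  show c: "c \<in> A" using assms unfolding slice_chart_def by blast
  have eq: "cmap c ` (cdom c \<inter> \<Sigma>) = cran c \<inter> ({0} \<times> UNIV)"
    by (rule conjunct2[OF assms[unfolded slice_chart_def]])
  show "cmap c x = (0, snd (cmap c x))" if "x \<in> cdom c" "x \<in> \<Sigma>"
  proof -
    have "cmap c x \<in> cran c \<inter> ({0} \<times> UNIV)" unfolding eq[symmetric] using that by blast
    then show ?thesis by (cases "cmap c x") auto
  qed
  show "cinv c (0, y) \<in> \<Sigma>" if "(0, y) \<in> cran c"
  proof -
    have "(0, y) \<in> cmap c ` (cdom c \<inter> \<Sigma>)" unfolding eq using that by blast
    then obtain p where "p \<in> cdom c" "p \<in> \<Sigma>" "(0, y) = cmap c p" by blast
    then show ?thesis using cinv_cmap[OF c, of p] by simp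
  qed
qed

text \<open>In each slice chart around \<open>\<sigma> t\<close> the first coordinate of the curve
  vanishes near \<open>t\<close>, hence so does its derivative. All slice charts are treated because
  \<open>tangent_space_sub\<close> quantifies over all of them.\<close>

lemma velocity_in_tangent_space_sub:
  assumes \<sigma>: "isCont \<sigma> t" and c: "c \<in> A" "\<sigma> t \<in> cdom c"
    and \<sigma>': "((cmap c \<circ> \<sigma>) has_vector_derivative w) (at t)"
    and in_slice: "\<sigma> t \<in> \<Sigma>" "\<forall>\<^sub>F s in at t. \<sigma> s \<in> \<Sigma>"
  shows "velocity A \<sigma> t \<in> tangent_space_sub A \<Sigma> (\<sigma> t)"
proof -
  have "fst (velocity A \<sigma> t d) = 0" if d: "slice_chart A \<Sigma> d" "\<sigma> t \<in> cdom d" for d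
  proof -
    have dA: "d \<in> A" by (rule slice_chartD(1)[OF d(1)])
    obtain w' where w': "((cmap d \<circ> \<sigma>) has_vector_derivative w') (at t)"
      using curve_change_chart[OF \<sigma> c(1) dA c(2) d(2) \<sigma>'] by blast
    have "\<forall>\<^sub>F s in at t. \<sigma> s \<in> cdom d"
      using \<sigma> d(2) open_cdom[OF dA] unfolding isCont_def tendsto_def by blast
    with in_slice(2) have ev: "\<forall>\<^sub>F s in at t. fst ((cmap d \<circ> \<sigma>) s) = 0"
    proof eventually_elim
      case (elim s)
      then show ?case using slice_chartD(2)[OF d(1), of "\<sigma> s"] by (metis comp_apply fst_conv)
    qed
    have 0: "fst ((cmap d \<circ> \<sigma>) t) = 0"
      using slice_chartD(2)[OF d(1,2) in_slice(1)] by (metis comp_apply fst_conv)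
    have "((\<lambda>s. fst ((cmap d \<circ> \<sigma>) s)) has_derivative (\<lambda>h. fst (h *\<^sub>R w'))) (at t)"
      using has_derivative_fst[OF w'[unfolded has_vector_derivative_def]] .
    then have "((\<lambda>s. 0) has_derivative (\<lambda>h. fst (h *\<^sub>R w'))) (at t)"
      by (rule has_derivative_transform_eventually[OF _ ev]) (use 0 in auto)
    then have "((\<lambda>s. 0) has_vector_derivative fst w') (at t)"
      by (simp add: has_vector_derivative_def)
    then have "fst w' = 0"
      using vector_derivative_unique_at has_vector_derivative_const by blast
    then show ?thesis using velocity_chart[OF dA d(2) w'] by simp
  qed
  then show ?thesis
    unfolding tangent_space_sub_def using velocity_in_tangent_space[OF \<sigma> c \<sigma>'] by blast
qed

lemma slice_chart_curve:
  assumes c: "slice_chart A \<Sigma> c" and \<eta>: "(\<eta> has_vector_derivative u) (at t)"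
    and ran: "(0, \<eta> t) \<in> cran c"
  defines "\<sigma> \<equiv> \<lambda>s. cinv c (0, \<eta> s)"
  shows "isCont \<sigma> t" and "\<sigma> t \<in> cdom c" and "((cmap c \<circ> \<sigma>) has_vector_derivative (0, u)) (at t)"
    and "velocity A \<sigma> t = tvec_of A (\<sigma> t) c (0, u)"
    and "tvec_of A (\<sigma> t) c (0, u) \<in> tangent_space_sub A \<Sigma> (\<sigma> t)"
proof -
  have cA: "c \<in> A" by (rule slice_chartD(1)[OF c])
  have "isCont \<eta> t" using \<eta> by (rule has_vector_derivative_continuous)
  then have cont: "isCont (\<lambda>s. (0::real, \<eta> s)) t" by (intro continuous_intros)
  have "isCont (cinv c) (0, \<eta> t)"
    by (rule continuous_on_interior[OF continuous_on_cinv[OF cA]])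
      (simp only: interior_open[OF open_cran[OF cA]] ran)
  with cont show \<sigma>: "isCont \<sigma> t" unfolding \<sigma>_def by (rule isCont_o2)
  show t: "\<sigma> t \<in> cdom c" unfolding \<sigma>_def by (rule cinv_in_cdom[OF cA ran])
  have in_ran: "\<forall>\<^sub>F s in at t. (0, \<eta> s) \<in> cran c"
    using cont open_cran[OF cA] ran unfolding isCont_def tendsto_def by blast
  then have ev: "\<forall>\<^sub>F s in at t. (0, \<eta> s) = (cmap c \<circ> \<sigma>) s"
    by eventually_elim (use cmap_cinv[OF cA] in \<open>simp add: \<sigma>_def\<close>)
  have "((\<lambda>s. (0::real, \<eta> s)) has_derivative (\<lambda>h. (h *\<^sub>R 0, h *\<^sub>R u))) (at t)"
    using has_derivative_Pair[OF _ \<eta>[unfolded has_vector_derivative_def], of "\<lambda>_. 0" "\<lambda>h. 0::real"] by simp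
  then have "((\<lambda>s. (0::real, \<eta> s)) has_derivative (\<lambda>h. h *\<^sub>R (0, u))) (at t)" by simp
  then show \<sigma>': "((cmap c \<circ> \<sigma>) has_vector_derivative (0, u)) (at t)"
    unfolding has_vector_derivative_def
    by (rule has_derivative_transform_eventually[OF _ ev]) (use cmap_cinv[OF cA ran] in \<open>simp_all add: \<sigma>_def\<close>)
  show v: "velocity A \<sigma> t = tvec_of A (\<sigma> t) c (0, u)" by (rule velocity_eq_tvec_of[OF \<sigma> cA t \<sigma>'])
  have "\<forall>\<^sub>F s in at t. \<sigma> s \<in> \<Sigma>"
    using in_ran by eventually_elim (use slice_chartD(3)[OF c] in \<open>simp add: \<sigma>_def\<close>)
  moreover have "\<sigma> t \<in> \<Sigma>" unfolding \<sigma>_def by (rule slice_chartD(3)[OF c ran])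
  ultimately show "tvec_of A (\<sigma> t) c (0, u) \<in> tangent_space_sub A \<Sigma> (\<sigma> t)"
    using velocity_in_tangent_space_sub[OF \<sigma> cA t \<sigma>'] unfolding v by blast
qed

text \<open>Tangency to the slice holds because the vector is the velocity of a straight line in the
  model hypersurface. The second claim prepares the use of homogeneity of
  \<open>F_ref\<close>.\<close>

lemma slice_tvec_of:
  assumes c: "slice_chart A \<Sigma> c" and y: "(0, y) \<in> cran c"
  shows "tvec_of A (cinv c (0, y)) c (0, u) \<in> tangent_space_sub A \<Sigma> (cinv c (0, y))"
    and "tvec_of A (cinv c (0, y)) c (0, k *\<^sub>R u) =
      lincomb k (tvec_of A (cinv c (0, y)) c (0, u)) 0 (tvec_of A (cinv c (0, y)) c (0, u))"
proof -
  have "((\<lambda>s. y + s *\<^sub>R u) has_vector_derivative u) (at 0)"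
    by (auto simp: has_vector_derivative_def intro!: derivative_eq_intros)
  from slice_chart_curve(5)[OF c this] y
  show "tvec_of A (cinv c (0, y)) c (0, u) \<in> tangent_space_sub A \<Sigma> (cinv c (0, y))" by simp
  let ?x = "cinv c (0, y)"
  have cA: "c \<in> A" by (rule slice_chartD(1)[OF c])
  have x: "?x \<in> cdom c" by (rule cinv_in_cdom[OF cA y])
  show "tvec_of A ?x c (0, k *\<^sub>R u) = lincomb k (tvec_of A ?x c (0, u)) 0 (tvec_of A ?x c (0, u))"
  proof
    fix d
    have "frechet_derivative (cmap d \<circ> cinv c) (at (cmap c ?x)) (0, k *\<^sub>R u) =
        k *\<^sub>R frechet_derivative (cmap d \<circ> cinv c) (at (cmap c ?x)) (0, u)"
      if "d \<in> A" "?x \<in> cdom d"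
      using linear_scale[OF transition_linear[OF cA that(1) x that(2)], of k "(0, u)"] by simp
    then show "tvec_of A ?x c (0, k *\<^sub>R u) d = lincomb k (tvec_of A ?x c (0, u)) 0 (tvec_of A ?x c (0, u)) d"
      by (simp add: tvec_of_def lincomb_def)
  qed
qed

text \<open>The domain \<open>UNIV \<times> B\<close> is open in \<open>real \<times> 's\<close>,
  which is also the model space of the charts, so read in a chart the map goes between spaces of
  equal dimension. It is injective because each flow line meets the slice once, and no
  differentiability or transversality enters.\<close>

lemma flow_out_open:
  assumes c: "slice_chart A \<Sigma> c" and B: "open B" "\<And>y. y \<in> B \<Longrightarrow> (0, y) \<in> cran c"
  shows "open ((\<lambda>(t, y). \<phi> t (cinv c (0, y))) ` (UNIV \<times> B))"
proof -
  let ?\<Psi> = "\<lambda>(t, y). \<phi> t (cinv c (0, y))"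
  have cA: "c \<in> A" by (rule slice_chartD(1)[OF c])
  have "continuous_on (UNIV \<times> B) (\<lambda>z. cinv c (0, snd z))"
    by (rule continuous_on_compose2[OF continuous_on_cinv[OF cA]]) (use B in \<open>auto intro!: continuous_intros\<close>)
  then have "continuous_on (UNIV \<times> B) (\<lambda>z. \<phi> (fst z) (cinv c (0, snd z)))"
    by (intro continuous_on_flow continuous_intros)
  then have cont: "continuous_on (UNIV \<times> B) ?\<Psi>" by (simp add: case_prod_beta)
  have inj: "inj_on ?\<Psi> (UNIV \<times> B)"
  proof (rule inj_onI, clarify)
    fix s t y z assume yz: "y \<in> B" "z \<in> B" and eq: "\<phi> s (cinv c (0, y)) = \<phi> t (cinv c (0, z))"
    have st: "s = t" and cyz: "cinv c (0, y) = cinv c (0, z)"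
      using flow_slice_injective[OF slice_chartD(3)[OF c B(2)[OF yz(1)]] slice_chartD(3)[OF c B(2)[OF yz(2)]] eq] by auto
    have "(0, y) = (0 :: real, z)"
      using arg_cong[OF cyz, of "cmap c"]
      unfolding cmap_cinv[OF cA B(2)[OF yz(1)]] cmap_cinv[OF cA B(2)[OF yz(2)]] .
    with st show "s = t \<and> y = z" by simp
  qed
  have openD: "open (UNIV \<times> B)" using B(1) by (simp add: open_Times)
  have "\<exists>U. open U \<and> q \<in> U \<and> U \<subseteq> ?\<Psi> ` (UNIV \<times> B)" if q: "q \<in> ?\<Psi> ` (UNIV \<times> B)" for q
  proof -
    obtain d where d: "d \<in> A" "q \<in> cdom d" by (rule chart_at)
    define W where "W = (UNIV \<times> B) \<inter> ?\<Psi> -` cdom d"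
    have W: "open W" unfolding W_def
      by (rule continuous_open_preimage[OF cont openD open_cdom[OF d(1)]])
    have "continuous_on W (\<lambda>z. cmap d (?\<Psi> z))"
      by (rule continuous_on_compose2[OF continuous_on_cmap[OF d(1)] continuous_on_subset[OF cont]])
        (auto simp: W_def)
    moreover have "inj_on (\<lambda>z. cmap d (?\<Psi> z)) W"
    proof (rule inj_onI)
      fix z z' assume z: "z \<in> W" "z' \<in> W" "cmap d (?\<Psi> z) = cmap d (?\<Psi> z')"
      have "?\<Psi> z \<in> cdom d" "?\<Psi> z' \<in> cdom d" using z unfolding W_def by blast+
      then have "?\<Psi> z = ?\<Psi> z'" using arg_cong[OF z(3), of "cinv d"] cinv_cmap[OF d(1)] by metis
      then show "z = z'" using inj z(1,2) unfolding W_def inj_on_def by blast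
    qed
    ultimately have "open ((\<lambda>z. cmap d (?\<Psi> z)) ` W)" using invariance_of_domain W by blast
    then have "open (cdom d \<inter> cmap d -` ((\<lambda>z. cmap d (?\<Psi> z)) ` W))"
      by (rule continuous_open_preimage[OF continuous_on_cmap[OF d(1)] open_cdom[OF d(1)]])
    moreover have "q \<in> cdom d \<inter> cmap d -` ((\<lambda>z. cmap d (?\<Psi> z)) ` W)"
      using q d(2) unfolding W_def by blast
    moreover have "p \<in> ?\<Psi> ` (UNIV \<times> B)"
      if p: "p \<in> cdom d \<inter> cmap d -` ((\<lambda>z. cmap d (?\<Psi> z)) ` W)" for p
    proof -
      obtain z where z: "z \<in> W" "cmap d p = cmap d (?\<Psi> z)" and pd: "p \<in> cdom d" using p by blast
      have "?\<Psi> z \<in> cdom d" using z unfolding W_def by blast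
      then have "p = ?\<Psi> z" using arg_cong[OF z(2), of "cinv d"] cinv_cmap[OF d(1)] pd by metis
      then show ?thesis using z(1) unfolding W_def by blast
    qed
    ultimately show ?thesis by blast
  qed
  then show ?thesis by (subst open_subopen) blast
qed

end

section \<open>Future-directed curves along the slice\<close>

context sliced_flow
begin

text \<open>Reachability in the time direction given by the sign: for \<open>s = 1\<close> the
  second point lies in the future of the first, for \<open>s = -1\<close> in its past.\<close>

definition precedes :: "real \<Rightarrow> 'm \<Rightarrow> 'm \<Rightarrow> bool" where
  "precedes s p q \<longleftrightarrow> (if s = 1 then chron_before A g T p q else chron_before A g T q p)"

lemma precedes_trans: "precedes s p q \<Longrightarrow> precedes s q r \<Longrightarrow> precedes s p r"
  unfolding precedes_def chron_before_def by (auto split: if_splits intro: tranclp_trans)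

text \<open>Continuity on the compact parameter interval yields the upper bound from which the
  constant \<open>C\<close> of the lift is made.\<close>

lemma F_ref_continuous_along_segment:
  assumes "one_form_sub A \<Sigma> \<omega>\<^sub>0" "riemannian_metric_sub A \<Sigma> g\<^sub>0" and c: "slice_chart A \<Sigma> c"
    and ran: "\<And>r. r \<in> {0..1} \<Longrightarrow> (0, y + r *\<^sub>R u) \<in> cran c"
  shows "continuous_on {0..1} (\<lambda>r. F_ref s \<omega>\<^sub>0 g\<^sub>0 (cinv c (0, y + r *\<^sub>R u)) (tvec_of A (cinv c (0, y + r *\<^sub>R u)) c (0, u)))"
proof -
  have l: "continuous_on {0..1} (\<lambda>r. y + r *\<^sub>R u)" by (intro continuous_intros)
  have "continuous_on {z. (0, z) \<in> cran c} (\<lambda>z. \<omega>\<^sub>0 (cinv c (0, z)) (tvec_of A (cinv c (0, z)) c (0, u)))"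
    using assms(1) c unfolding one_form_sub_def Let_def by (intro smooth_on_continuous_on) blast
  from continuous_on_compose2[OF this l]
  have \<omega>: "continuous_on {0..1} (\<lambda>r. \<omega>\<^sub>0 (cinv c (0, y + r *\<^sub>R u)) (tvec_of A (cinv c (0, y + r *\<^sub>R u)) c (0, u)))"
    using ran by blast
  have "continuous_on {z. (0, z) \<in> cran c} (\<lambda>z. g\<^sub>0 (cinv c (0, z)) (tvec_of A (cinv c (0, z)) c (0, u)) (tvec_of A (cinv c (0, z)) c (0, u)))"
    using assms(2) c unfolding riemannian_metric_sub_def Let_def by (intro smooth_on_continuous_on) blast
  from continuous_on_compose2[OF this l]
  have g: "continuous_on {0..1} (\<lambda>r. g\<^sub>0 (cinv c (0, y + r *\<^sub>R u)) (tvec_of A (cinv c (0, y + r *\<^sub>R u)) c (0, u)) (tvec_of A (cinv c (0, y + r *\<^sub>R u)) c (0, u)))"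
    using ran by blast
  show ?thesis unfolding F_ref_def by (intro continuous_intros \<omega> g)
qed

text \<open>The hypothesis \<open>reach\<close> is all that remains here of the divergent integral;
  \<open>s * (t - \<tau>) > 0\<close> says that the lift leaves \<open>\<tau>\<close> forwards for
  \<open>s = 1\<close> and backwards for \<open>s = -1\<close>. Convexity of \<open>B\<close> keeps
  the straight segment inside the chart.\<close>

lemma slice_chart_precedes:
  assumes s: "s = 1 \<or> s = -1"
    and tame: "tame_bound s A g \<phi> \<Sigma> \<aa>" and a: "smooth_on UNIV \<aa>" "\<And>t. \<aa> t > 0"
    and G: "\<And>t. (G has_real_derivative 1 / \<aa> t) (at t)"
    and reach: "\<And>C. C > 0 \<Longrightarrow> \<exists>t. s * (t - \<tau>) > 0 \<and> s * (G t - G \<tau>) = C"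
    and c: "slice_chart A \<Sigma> c" and B: "convex B" "\<And>y. y \<in> B \<Longrightarrow> (0, y) \<in> cran c"
    and y: "y \<in> B" "z \<in> B"
  shows "\<exists>\<tau>'. precedes s (\<phi> \<tau> (cinv c (0, y))) (\<phi> \<tau>' (cinv c (0, z)))"
proof -
  have cA: "c \<in> A" by (rule slice_chartD(1)[OF c])
  obtain \<omega>\<^sub>0 g\<^sub>0 where \<omega>: "one_form_sub A \<Sigma> \<omega>\<^sub>0" and g0: "riemannian_metric_sub A \<Sigma> g\<^sub>0"
    and bound: "\<And>\<tau> x v. x \<in> \<Sigma> \<Longrightarrow> v \<in> tangent_space_sub A \<Sigma> x \<Longrightarrow>
       F_flow s A g \<phi> \<tau> x v \<le> \<aa> \<tau> * lapse A g \<phi> \<tau> x * F_ref s \<omega>\<^sub>0 g\<^sub>0 x v"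
    using tame unfolding tame_bound_def by blast
  define u where "u = z - y"
  define x where "x r = cinv c (0, y + r *\<^sub>R u)" for r :: real
  have ran: "(0, y + r *\<^sub>R u) \<in> cran c" if "r \<in> {0..1}" for r
  proof -
    have "y + r *\<^sub>R u = (1 - r) *\<^sub>R y + r *\<^sub>R z" unfolding u_def by (simp add: algebra_simps)
    then show ?thesis using B(2) convexD_alt[OF B(1) y, of r] that by simp
  qed
  let ?N = "\<lambda>r. F_ref s \<omega>\<^sub>0 g\<^sub>0 (x r) (tvec_of A (x r) c (0, u))"
  have "compact (?N ` {0..1})"
    unfolding x_def
    by (intro compact_continuous_image F_ref_continuous_along_segment[OF \<omega> g0 c ran]) auto
  then have "bdd_above (?N ` {0..1})" by (intro bounded_imp_bdd_above compact_imp_bounded)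
  then obtain K where K: "\<forall>n \<in> ?N ` {0..1}. n \<le> K" unfolding bdd_above_def ..
  \<comment> \<open>The absolute value makes \<open>C\<close> positive even if \<open>K\<close> is
    not, and the added \<open>1\<close> makes the bound strict, as timelikeness requires.\<close>
  define C where "C = \<bar>K\<bar> + 1"
  have C: "C > 0" unfolding C_def by linarith
  have N_less: "?N r < C" if "r \<in> {0..1}" for r
    using bspec[OF K imageI[OF that]] unfolding C_def by linarith
  obtain \<tau>' where \<tau>': "s * (\<tau>' - \<tau>) > 0" "s * (G \<tau>' - G \<tau>) = C" using reach[OF C] by blast
  \<comment> \<open>The position on the segment at time \<open>t\<close>: normalised by the choice
    of \<open>\<tau>'\<close>, it is \<open>0\<close> at \<open>\<tau>\<close> and \<open>1\<close>
    at \<open>\<tau>'\<close>. For \<open>s = -1\<close> it decreases in \<open>t\<close>, because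
    the segment is then traversed backwards in time.\<close>
  define f where "f t = s / C * (G t - G \<tau>)" for t
  define h where "h t = s / C * inverse (\<aa> t)" for t
  have f': "(f has_real_derivative h t) (at t)" for t
    unfolding f_def h_def using G[of t] C by (auto intro!: derivative_eq_intros simp: field_simps)
  have f0: "f \<tau> = 0" and f1: "f \<tau>' = 1"
    using \<tau>'(2) C by (simp_all add: f_def field_simps)
  have G_mono: "G t \<le> G t'" if "t \<le> t'" for t t'
    by (rule DERIV_nonneg_imp_nondecreasing[OF that]) (use G a(2) less_imp_le in \<open>metis divide_pos_pos zero_less_one\<close>)
  \<comment> \<open>A timelike segment is parametrised towards the future, so for
    \<open>s = -1\<close> it starts at \<open>\<tau>'\<close> and ends at
    \<open>\<tau>\<close>.\<close>
  define lo hi where "lo = min \<tau> \<tau>'" and "hi = max \<tau> \<tau>'"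
  have "lo < hi" using \<tau>'(1) unfolding lo_def hi_def by (cases "\<tau> = \<tau>'") (auto simp: min_def max_def)
  have f_range: "f t \<in> {0..1}" if t: "t \<in> {lo..hi}" for t
  proof (cases "s = 1")
    case True
    then have "\<tau> \<le> t" "t \<le> \<tau>'" using t \<tau>'(1) unfolding lo_def hi_def by auto
    then have "0 \<le> G t - G \<tau>" "G t - G \<tau> \<le> C" using G_mono \<tau>'(2) True by force+
    then show ?thesis using C True by (simp add: f_def)
  next
    case False
    then have s: "s = -1" using s by blast
    then have "t \<le> \<tau>" "\<tau>' \<le> t" using t \<tau>'(1) unfolding lo_def hi_def by auto
    then have "0 \<le> G \<tau> - G t" "G \<tau> - G t \<le> C" using G_mono[of t \<tau>] G_mono[of \<tau>' t] \<tau>'(2) s by auto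
    then show ?thesis using C s by (simp add: f_def field_simps)
  qed
  let ?\<gamma> = "\<lambda>t. \<phi> t (x (f t))"
  let ?l = "\<lambda>t. (0::real, y + f t *\<^sub>R u)"
  \<comment> \<open>Smoothness is required on an open neighbourhood of the interval, where
    \<open>f\<close> may leave \<open>{0..1}\<close>; \<open>J\<close> collects the times at which
    the extended line is still in the chart.\<close>
  define J where "J = ?l -` cran c"
  have Ck_l: "Ck_on k UNIV (\<lambda>t. (t, ?l t))" for k
  proof -
    have "Ck_on k UNIV h"
      unfolding h_def using a
      by (intro Ck_on_bilinear[OF _ bounded_bilinear_mult] Ck_on_const Ck_on_inverse)
        (auto simp: smooth_on_def less_imp_neq[THEN not_sym])
    then have f: "Ck_on k UNIV f" by (rule Ck_on_antiderivative[OF open_UNIV f'])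
    show ?thesis
      by (intro Ck_on_Pair Ck_on_add Ck_on_bilinear[OF _ bounded_bilinear_scaleR] Ck_on_const f open_UNIV
          Ck_on_bounded_linear[OF open_UNIV bounded_linear_ident])
  qed
  have cont_l: "continuous_on UNIV ?l"
    using continuous_on_snd[OF Ck_l[of 0, simplified]] by simp
  have openJ: "open J"
    unfolding J_def using open_vimage[OF open_cran[OF cA] cont_l] .
  have sub: "{lo..hi} \<subseteq> J" using ran f_range unfolding J_def by auto
  have cont_x: "continuous_on J (\<lambda>t. x (f t))"
    unfolding x_def
    by (rule continuous_on_compose2[OF continuous_on_cinv[OF cA] continuous_on_subset[OF cont_l]])
      (auto simp: J_def)
  have cont: "continuous_on J ?\<gamma>" by (intro continuous_on_flow continuous_intros cont_x)
  have smooth: "smooth_curve_on A J ?\<gamma>"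
    unfolding smooth_curve_on_def
  proof (intro conjI ballI openJ cont)
    fix d assume d: "d \<in> A"
    let ?S = "{t \<in> J. ?\<gamma> t \<in> cdom d}"
    have "?S = J \<inter> ?\<gamma> -` cdom d" by auto
    then have openS: "open ?S" using continuous_open_preimage[OF cont openJ open_cdom[OF d]] by simp
    show "smooth_on ?S (cmap d \<circ> ?\<gamma>)"
      unfolding smooth_on_def
    proof
      fix k
      have "Ck_on k ?S (\<lambda>t. flow_chart c d (t, ?l t))"
      proof (rule Ck_on_compose[OF openS, where f = "\<lambda>t. (t, ?l t)" and g = "flow_chart c d"
            and T = "{(t, y). y \<in> cran c \<and> \<phi> t (cinv c y) \<in> cdom d}"])
        show "Ck_on k ?S (\<lambda>t. (t, ?l t))" using Ck_on_subset[OF Ck_l] by blast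
        show "Ck_on k {(t, y). y \<in> cran c \<and> \<phi> t (cinv c y) \<in> cdom d} (flow_chart c d)"
          using smooth_flow_chart[OF cA d] unfolding smooth_on_def by blast
        show "(\<lambda>t. (t, ?l t)) ` ?S \<subseteq> {(t, y). y \<in> cran c \<and> \<phi> t (cinv c y) \<in> cdom d}"
          unfolding J_def x_def by auto
      qed
      then show "Ck_on k ?S (cmap d \<circ> ?\<gamma>)" by (simp add: o_def x_def)
    qed
  qed
  have timelike: "future_timelike A g T (?\<gamma> t) (velocity A ?\<gamma> t)" if t: "t \<in> {lo..hi}" for t
  proof -
    have r: "(0, y + f t *\<^sub>R u) \<in> cran c" using ran f_range[OF t] by blast
    have "((\<lambda>t. y + f t *\<^sub>R u) has_vector_derivative h t *\<^sub>R u) (at t)"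
      using f'[of t] by (auto simp: has_vector_derivative_def has_field_derivative_def intro!: derivative_eq_intros)
    note curve = slice_chart_curve[OF c this r, folded x_def]
    let ?v = "tvec_of A (x (f t)) c (0, u)" and ?w = "tvec_of A (x (f t)) c (0, h t *\<^sub>R u)"
    have vel: "velocity A ?\<gamma> t = flow_differential A \<phi> t (x (f t)) (1, ?w)"
      using velocity_flow(1)[OF curve(1) cA curve(2,3) has_vector_derivative_id] curve(4) by simp
    have wT: "?w \<in> tangent_space A (x (f t))"
      using curve(5) unfolding tangent_space_sub_def by blast
    have xS: "x (f t) \<in> \<Sigma>" unfolding x_def by (rule slice_chartD(3)[OF c r])
    \<comment> \<open>\<open>?k\<close> is \<open>s * h t\<close>, since \<open>s * s = 1\<close>.
      Multiplying the slice velocity by \<open>s\<close> thus gives a positive multiple of the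
      segment direction in both cases, as homogeneity of \<open>F_ref\<close> requires.\<close>
    let ?k = "inverse (C * \<aa> t)"
    have k: "?k > 0" using C a(2) by simp
    have "lincomb s ?w 0 ?w = tvec_of A (x (f t)) c (0, s *\<^sub>R h t *\<^sub>R u)"
      unfolding x_def by (rule slice_tvec_of(2)[OF c r, symmetric])
    also have "s *\<^sub>R h t *\<^sub>R u = ?k *\<^sub>R u"
      using s C a(2)[of t] by (auto simp: h_def field_simps)
    finally have sw: "lincomb s ?w 0 ?w = tvec_of A (x (f t)) c (0, ?k *\<^sub>R u)" .
    have kv: "tvec_of A (x (f t)) c (0, ?k *\<^sub>R u) = lincomb ?k ?v 0 ?v"
      unfolding x_def by (rule slice_tvec_of(2)[OF c r])
    have vS: "?v \<in> tangent_space_sub A \<Sigma> (x (f t))"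
      "tvec_of A (x (f t)) c (0, ?k *\<^sub>R u) \<in> tangent_space_sub A \<Sigma> (x (f t))"
      unfolding x_def by (rule slice_tvec_of(1)[OF c r])+
    let ?\<beta> = "lapse A g \<phi> t (x (f t))"
    have \<beta>: "?\<beta> > 0"
      using X_timelike unfolding lapse_def flow_pullback_def flow_differential_time by simp
    have "F_flow s A g \<phi> t (x (f t)) (lincomb s ?w 0 ?w) \<le> \<aa> t * ?\<beta> * (?k * ?N (f t))"
      using bound[OF xS vS(2), of t] F_ref_scale[OF \<omega> g0 xS vS(1), of ?k s] vS(2) k unfolding sw kv by simp
    \<comment> \<open>The factor \<open>\<aa> t\<close> from tameness cancels against the speed;
      this is what dictates the derivative of \<open>f\<close>.\<close>
    also have "\<dots> = ?\<beta> * (?N (f t) / C)" using C a(2)[of t] by (simp add: field_simps)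
    also have "\<dots> < ?\<beta>" using N_less[OF f_range[OF t]] C \<beta> by (simp add: field_simps)
    finally show ?thesis
      unfolding vel by (rule future_timelike_flow_differential[OF wT s])
  qed
  have seg: "timelike_segment A g T (?\<gamma> lo) (?\<gamma> hi)"
    unfolding timelike_segment_def using \<open>lo < hi\<close> sub smooth timelike by blast
  have ends: "?\<gamma> \<tau> = \<phi> \<tau> (cinv c (0, y))" "?\<gamma> \<tau>' = \<phi> \<tau>' (cinv c (0, z))"
    by (simp_all add: f0 f1 x_def u_def)
  have "precedes s (?\<gamma> \<tau>) (?\<gamma> \<tau>')"
  proof (cases "s = 1")
    case True
    then have "lo = \<tau>" "hi = \<tau>'" using \<tau>'(1) unfolding lo_def hi_def by auto
    then show ?thesis using seg True unfolding precedes_def chron_before_def by auto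
  next
    case False
    then have "lo = \<tau>'" "hi = \<tau>" using s \<tau>'(1) unfolding lo_def hi_def by auto
    then show ?thesis using seg False unfolding precedes_def chron_before_def by auto
  qed
  then show ?thesis unfolding ends by blast
qed

text \<open>Reachability is passed to a relation \<open>R\<close> between points of the slice. Near
  each point \<open>R\<close> holds in both directions, so the points of \<open>M\<close> whose
  slice point is related to a fixed \<open>x1\<close>, and the remaining ones, both form open
  sets.\<close>

lemma flow_lines_precede:
  assumes local: "\<And>c B y z \<tau>. slice_chart A \<Sigma> c \<Longrightarrow> convex B \<Longrightarrow> (\<And>y. y \<in> B \<Longrightarrow> (0, y) \<in> cran c) \<Longrightarrow>
    y \<in> B \<Longrightarrow> z \<in> B \<Longrightarrow> \<exists>\<tau>'. precedes s (\<phi> \<tau> (cinv c (0, y))) (\<phi> \<tau>' (cinv c (0, z)))"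
  shows "\<exists>\<tau>'. precedes s p (\<phi> \<tau>' q)"
proof -
  \<comment> \<open>Quantifying over every start time makes \<open>R\<close> transitive: the arrival
    time of one lift is not under control, yet the next must start there.\<close>
  define R where "R x x' \<longleftrightarrow> (\<forall>\<tau>. \<exists>\<tau>'. precedes s (\<phi> \<tau> x) (\<phi> \<tau>' x'))" for x x'
  have R_trans: "R x x''" if "R x x'" "R x' x''" for x x' x''
    using that precedes_trans unfolding R_def by blast
  \<comment> \<open>A segment in the ball can be traversed from either end, each direction with its
    own constant; this gives both \<open>R x x'\<close> and \<open>R x' x\<close>.\<close>
  have nbhd: "\<exists>U. open U \<and> \<phi> t x \<in> U \<and>
      U \<subseteq> {\<phi> t' x' | t' x'. x' \<in> \<Sigma> \<and> R x x' \<and> R x' x}" if x: "x \<in> \<Sigma>" for t x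
  proof -
    obtain c where c: "slice_chart A \<Sigma> c" "x \<in> cdom c"
      using x slice unfolding slice_def hypersurface_def by blast
    have cA: "c \<in> A" by (rule slice_chartD(1)[OF c(1)])
    obtain y where y: "cmap c x = (0, y)" using slice_chartD(2)[OF c(1,2) x] by blast
    have xy: "x = cinv c (0, y)" using cinv_cmap[OF cA c(2)] y by simp
    have "(0, y) \<in> cran c" using c(2) y by (metis imageI)
    then obtain e where e: "e > 0" "ball (0, y) e \<subseteq> cran c"
      using open_cran[OF cA] open_contains_ball by blast
    have B: "(0, z) \<in> cran c" if "z \<in> ball y e" for z
      using that e(2) by (auto simp: dist_Pair_Pair subset_iff)
    have yB: "y \<in> ball y e" using e(1) by simp
    let ?U = "(\<lambda>(t, y). \<phi> t (cinv c (0, y))) ` (UNIV \<times> ball y e)"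
    have "\<phi> t x \<in> ?U" unfolding xy by (rule image_eqI[of _ _ "(t, y)"]) (simp_all add: e(1))
    moreover have "?U \<subseteq> {\<phi> t' x' | t' x'. x' \<in> \<Sigma> \<and> R x x' \<and> R x' x}"
    proof (rule subsetI)
      fix p assume "p \<in> ?U"
      then obtain t' z where z: "z \<in> ball y e" "p = \<phi> t' (cinv c (0, z))" by auto
      have "cinv c (0, z) \<in> \<Sigma>" by (rule slice_chartD(3)[OF c(1) B[OF z(1)]])
      moreover have "R x (cinv c (0, z))" "R (cinv c (0, z)) x"
        unfolding R_def xy using local[OF c(1) convex_ball B _ _] yB z(1) by blast+
      ultimately show "p \<in> {\<phi> t' x' | t' x'. x' \<in> \<Sigma> \<and> R x x' \<and> R x' x}" using z(2) by blast
    qed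
    moreover have "open ?U" by (rule flow_out_open[OF c(1) open_ball B])
    ultimately show ?thesis by blast
  qed
  obtain \<tau>q x1 where q: "x1 \<in> \<Sigma>" "q = \<phi> \<tau>q x1" using flow_to_slice .
  obtain \<tau>p x0 where p: "x0 \<in> \<Sigma>" "p = \<phi> \<tau>p x0" using flow_to_slice .
  \<comment> \<open>As \<open>R\<close> is not assumed symmetric, openness of \<open>?U\<close> uses
    \<open>R x' x\<close> and openness of \<open>?V\<close> uses \<open>R x x'\<close>. They are
    disjoint because a point determines its slice point.\<close>
  let ?U = "{\<phi> t x | t x. x \<in> \<Sigma> \<and> R x x1}" and ?V = "{\<phi> t x | t x. x \<in> \<Sigma> \<and> \<not> R x x1}"
  have "open ?U"
    unfolding open_subopen[of ?U]
  proof (rule ballI)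
    fix p assume "p \<in> ?U"
    then obtain t x where x: "x \<in> \<Sigma>" "R x x1" "p = \<phi> t x" by blast
    from nbhd[OF x(1), of t] obtain U where
      "open U" "p \<in> U" "U \<subseteq> {\<phi> t' x' | t' x'. x' \<in> \<Sigma> \<and> R x x' \<and> R x' x}" unfolding x(3) by blast
    then show "\<exists>U. open U \<and> p \<in> U \<and> U \<subseteq> ?U" using R_trans[OF _ x(2)] by fast
  qed
  moreover have "open ?V"
    unfolding open_subopen[of ?V]
  proof (rule ballI)
    fix p assume "p \<in> ?V"
    then obtain t x where x: "x \<in> \<Sigma>" "\<not> R x x1" "p = \<phi> t x" by blast
    from nbhd[OF x(1), of t] obtain U where
      "open U" "p \<in> U" "U \<subseteq> {\<phi> t' x' | t' x'. x' \<in> \<Sigma> \<and> R x x' \<and> R x' x}" unfolding x(3) by blast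
    then show "\<exists>U. open U \<and> p \<in> U \<and> U \<subseteq> ?V" using R_trans x(2) by fast
  qed
  moreover have "?U \<inter> ?V = {}" using flow_slice_injective(2) by blast
  moreover have "UNIV \<subseteq> ?U \<union> ?V"
  proof
    fix p :: 'm
    obtain t x where "x \<in> \<Sigma>" "p = \<phi> t x" by (rule flow_to_slice)
    then show "p \<in> ?U \<union> ?V" by blast
  qed
  \<comment> \<open>Nonemptiness amounts to \<open>R x1 x1\<close>, which is not automatic for a
    chronological relation; it is contained in the local statement at \<open>x1\<close>, with a
    constant segment.\<close>
  moreover have "x1 \<in> ?U"
  proof -
    obtain t x where "x1 = \<phi> t x" "x \<in> \<Sigma>" "R x1 x" "R x x1"
      using nbhd[OF q(1), of 0] unfolding flow_zero by blast
    then show ?thesis by blast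
  qed
  moreover have "connected (UNIV :: 'm set)" using spacetime unfolding spacetime_def by blast
  ultimately have "?V = {}"
    unfolding connected_def by blast
  then have "R x0 x1" using p(1) by blast
  then obtain \<tau>' where "precedes s p (\<phi> \<tau>' x1)" unfolding R_def p(2) by blast
  \<comment> \<open>The time is re-counted from \<open>q\<close> instead of from the slice point of
    its flow line.\<close>
  moreover have "\<phi> \<tau>' x1 = \<phi> (\<tau>' - \<tau>q) q" unfolding q(2) using flow_add[of "\<tau>' - \<tau>q" \<tau>q x1] by simp
  ultimately show ?thesis by metis
qed

end

theorem theorem2p5:
  fixes A :: "('m::{t2_space,second_countable_topology}, real \<times> 's::euclidean_space) chart set"
    and g :: "'m \<Rightarrow> ('m, real \<times> 's) tvec \<Rightarrow> ('m, real \<times> 's) tvec \<Rightarrow> real"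
    and T X :: "'m \<Rightarrow> ('m, real \<times> 's) tvec"
    and \<phi> :: "real \<Rightarrow> 'm \<Rightarrow> 'm"
  assumes "spacetime A g T"
    and "vector_field A X"
    and "\<forall>p. future_timelike A g T p (X p)"
    and "complete_with_flow A X \<phi>"
  shows "(future_tame A g X \<phi> \<longrightarrow> future_omniscient A g T (integral_foliation A X)) \<and>
         (past_tame A g X \<phi> \<longrightarrow> past_omniscient A g T (integral_foliation A X))"
proof -
  interpret spacetime_flow A g T X \<phi>
    using assms by unfold_locales (auto simp: spacetime_def)
  \<comment> \<open>The set of \<open>t\<close> with \<open>s * t \<ge> 0\<close> is the right
    half-line for \<open>s = 1\<close> and the left one for \<open>s = -1\<close>, so that one
    statement covers both integral conditions.\<close>
  have precedes: "\<exists>\<tau>'. sliced_flow.precedes A g T s p (\<phi> \<tau>' q)"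
    if s: "s = 1 \<or> s = -1" and \<Sigma>: "slice A X \<Sigma>" and a: "smooth_on UNIV \<aa>" "\<And>t. \<aa> t > 0"
      and tame: "tame_bound s A g \<phi> \<Sigma> \<aa>"
      and inf: "(\<integral>\<^sup>+t\<in>{t. s * t \<ge> 0}. ennreal (1 / \<aa> t) \<partial>lborel) = \<infinity>" for s \<Sigma> \<aa> p q
  proof -
    interpret sliced_flow A g T X \<phi> \<Sigma> using \<Sigma> by unfold_locales
    have cont: "continuous_on UNIV (\<lambda>t. 1 / \<aa> t)"
      using smooth_on_continuous_on[OF a(1)] a(2) by (intro continuous_intros) (auto simp: less_imp_neq[THEN not_sym])
    obtain G where G: "\<And>t. (G has_real_derivative 1 / \<aa> t) (at t)"
      using antiderivative_real_line[OF cont] by blast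
    have pos: "1 / \<aa> t > 0" for t using a(2) by simp
    have reach: "\<exists>t. s * (t - \<tau>) > 0 \<and> s * (G t - G \<tau>) = C" if C: "C > 0" for C \<tau>
    proof (cases "s = 1")
      case True
      then have "(\<integral>\<^sup>+t\<in>{0..}. ennreal (1 / \<aa> t) \<partial>lborel) = \<infinity>" using inf by (simp add: atLeast_def)
      from antiderivative_reaches[OF G pos cont this C, of \<tau>] show ?thesis using True by auto
    next
      case False
      then have s: "s = -1" using s by blast
      then have "(\<integral>\<^sup>+t\<in>{..0}. ennreal (1 / \<aa> t) \<partial>lborel) = \<infinity>" using inf by (simp add: atMost_def)
      from antiderivative_reaches_left[OF G pos cont this C, of \<tau>] show ?thesis using s by auto
    qed
    show ?thesis
      by (rule flow_lines_precede, rule slice_chart_precedes[OF s tame a G reach])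
  qed
  show ?thesis
  proof (intro conjI impI)
    assume "future_tame A g X \<phi>"
    then obtain \<Sigma> \<aa> where *: "slice A X \<Sigma>" "smooth_on UNIV \<aa>" "\<And>t. \<aa> t > 0" "tame_bound 1 A g \<phi> \<Sigma> \<aa>"
      "(\<integral>\<^sup>+t\<in>{0..}. ennreal (1 / \<aa> t) \<partial>lborel) = \<infinity>"
      unfolding future_tame_def by blast
    interpret sliced_flow A g T X \<phi> \<Sigma> using *(1) by unfold_locales
    have "\<exists>\<tau>'. chron_before A g T p (\<phi> \<tau>' q)" for p q
      using precedes[OF _ *(1-4), of p q] *(5) unfolding precedes_def by (simp add: atLeast_def)
    then show "future_omniscient A g T (integral_foliation A X)"
      unfolding future_omniscient_def chron_past_def by (auto elim!: integral_foliation_eq_flow)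
  next
    assume "past_tame A g X \<phi>"
    then obtain \<Sigma> \<aa> where *: "slice A X \<Sigma>" "smooth_on UNIV \<aa>" "\<And>t. \<aa> t > 0" "tame_bound (-1) A g \<phi> \<Sigma> \<aa>"
      "(\<integral>\<^sup>+t\<in>{..0}. ennreal (1 / \<aa> t) \<partial>lborel) = \<infinity>"
      unfolding past_tame_def by blast
    interpret sliced_flow A g T X \<phi> \<Sigma> using *(1) by unfold_locales
    have "\<exists>\<tau>'. chron_before A g T (\<phi> \<tau>' q) p" for p q
      using precedes[OF _ *(1-4), of p q] *(5) unfolding precedes_def by (simp add: atMost_def)
    then show "past_omniscient A g T (integral_foliation A X)"
      unfolding past_omniscient_def chron_future_def by (auto elim!: integral_foliation_eq_flow)
  qed
qed

end
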